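(* Let $r\ge 1$, $q=2^r$, and for $n\ge 1$ let $A_r(n)$ denote the number of $A$-polynomials of degree $n$ in $\mathbb F_{q}[T]$. (a) Write $n=2^k m$ with $k\ge 0$ and $m$ odd, and let $\alpha=\frac{-1+\sqrt{-7}}{2}$, with $\overline{\alpha}$ its complex conjugate. Then $$A_r(n)=\frac{1}{4n}\sum_{d\mid m}\mu\Bigl(\frac{m}{d}\Bigr)\bigl(q^{2^k d}+1-\alpha^{r2^k d}-\overline{\alpha}^{\,r2^k d}\bigr),$$ where $\mu$ is the Möbius function. In particular, $$\left|A_r(n)-\frac{q^n}{4n}\right|\le \frac{\sigma_0(m)}{4n}\bigl(q^{n/3}+1+2\cdot 2^{rn/6}\bigr),$$ where $\sigma_0(m)$ is the number of positive divisors of $m$. Hence $A_r(n)\sim \frac{q^n}{4n}$ as $n\to\infty$. (b) If $(r,n)\neq(1,3)$, then $A_r(n)\ge 1$.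
   Context: Let $q=2^r$ and $\mathbb F_q$ the finite field with $q$ elements. A monic irreducible polynomial $f(T)=T^n+a_{n-1}T^{n-1}+\dots+a_1T+a_0\in\mathbb F_q[T]$ of degree $n$ is called an $A$-polynomial if $\mathrm{Tr}_{\mathbb F_q/\mathbb F_2}(a_{n-1})=1$ and $\mathrm{Tr}_{\mathbb F_q/\mathbb F_2}(a_1/a_0)=1$.
   Formalization: The displayed error bound is false as printed (r=1, n=8: A_1(8)=9, q^n/(4n)=8, right side < 0.39); the term 2·2^{rn/2}/(4n), the omitted contribution of α^{rn} and its conjugate from d=m, is added to its right side. *)

theory Defs
  imports
    Complex_Main
    "HOL-Library.Landau_Symbols"
    "HOL-Library.Cardinality"
    "HOL-Computational_Algebra.Computational_Algebra"
begin

(* The absolute trace of a field with 2^r elements, as the sum of the conjugates of x over the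
   prime field. Its values are kept in the big field, where they are 0 or 1. *)
definition trace2 :: "nat \<Rightarrow> 'a::field \<Rightarrow> 'a" where
  "trace2 r x = (\<Sum>i<r. x ^ (2 ^ i))"

(* An irreducible polynomial has positive degree. Its constant coefficient can only vanish for
   the polynomial T, where division by zero does no harm: the first trace condition already
   excludes T. *)
definition A_polynomial :: "nat \<Rightarrow> 'a::field poly \<Rightarrow> bool" where
  "A_polynomial r f \<longleftrightarrow>
     lead_coeff f = 1 \<and> irreducible f \<and>
     trace2 r (coeff f (degree f - 1)) = 1 \<and>
     trace2 r (coeff f 1 / coeff f 0) = 1"

(* The field with 2^r elements is the type argument 'a. *)
definition A_count :: "'a::field itself \<Rightarrow> nat \<Rightarrow> nat \<Rightarrow> nat" where
  "A_count _ r n = card {f :: 'a poly. A_polynomial r f \<and> degree f = n}"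

definition moebius :: "nat \<Rightarrow> int" where
  "moebius n = (if squarefree n then (- 1) ^ card (prime_factors n) else 0)"

definition sigma0 :: "nat \<Rightarrow> nat" where
  "sigma0 n = card {d. d dvd n}"

definition alpha :: complex where
  "alpha = (- 1 + csqrt (- 7)) / 2"

end

(* Attach to a monic f with f(0) /= 0 the sums s(f), t(f) of its roots and of their inverses, and
   put psi_{u,v}(f) = chi (u s(f) + v t(f)), where chi is the additive character given by the trace.
   This is multiplicative in f, so an Euler product relates its sums over monic polynomials of a
   given degree to the power sums of its values at irreducible polynomials. The former vanish from
   degree 3 on, which makes the L-function at most quadratic and yields closed formulas for the
   power sums; combining (u,v) = (0,0), (1,0), (0,1), (1,1) isolates the A-polynomials. No
   extension of the base field is needed.

   The linear coefficient for (1,1) is the Kloosterman sum over F_q. It is itself a power sum of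
   degree r over F_2, because the nonzero elements of F_q are grouped by their minimal polynomials;
   over F_2 the L-function is 1 + T + 2 T^2, with reciprocal roots alpha and its conjugate. *)

theory Submission
  imports Defs
begin

section \<open>Monic polynomials and the Newton identities\<close>

text \<open>The n-th power sum stands for a character sum over the extension of degree n whose
  points have been grouped by minimal polynomial. In characteristic 2 the character is a sign, so
  integers suffice until the L-function is factored, but signs also lose information: an irreducible
  P of degree d enters the n-th power sum through the (n/d)-th power of its value, which is blind to
  the sign when n/d is even. Hence only divisors with odd quotient survive, the 2-part of n is
  shared by all of them, and the Moebius sum runs over the divisors of the odd part m. The quantity
  being inverted is the point count of an elliptic curve, so its deviation from q^n + 1 obeys the
  Hasse bound. The exceptional pair is genuine: for q = 2 the curve has 4 points both for n = 1 and
  for n = 3, so the difference that counts the cubic A-polynomials is 0.\<close>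

definition monics :: "nat \<Rightarrow> 'a::field poly set" where
  "monics n = {f. lead_coeff f = 1 \<and> degree f = n}"

definition monic_irreds :: "'a::field poly set" where
  "monic_irreds = {P. lead_coeff P = 1 \<and> irreducible P}"

lemma monics_0: "monics 0 = {1 :: 'a::field poly}"
  by (auto simp: monics_def elim!: degree_eq_zeroE simp: one_pCons)

lemma monics_Suc: "monics (Suc n) = (\<lambda>(a, g). pCons a g) ` (UNIV \<times> monics n)" (is "_ = ?R")
proof (intro equalityI subsetI)
  fix f :: "'a poly" assume f: "f \<in> monics (Suc n)"
  obtain a g where fg: "f = pCons a g" by (cases f) auto
  with f have "g \<noteq> 0" by (auto simp: monics_def)
  with f fg show "f \<in> ?R" by (auto simp: monics_def)
next
  fix f :: "'a poly" assume "f \<in> ?R"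
  then obtain a g where fg: "f = pCons a g" "g \<in> monics n" by auto
  then have "g \<noteq> 0" by (auto simp: monics_def)
  with fg show "f \<in> monics (Suc n)" by (auto simp: monics_def)
qed

lemma finite_monics [simp]: "finite (monics n :: 'a::{field,finite} poly set)"
  by (induction n) (auto simp: monics_0 monics_Suc)

lemma sum_monics_Suc:
  "(\<Sum>f\<in>monics (Suc n). F f) = (\<Sum>a\<in>UNIV. \<Sum>g\<in>monics n. F (pCons (a :: 'a::{field,finite}) g))"
proof -
  have inj: "inj_on (\<lambda>(a, g). pCons a g) (UNIV \<times> monics n)"
    by (auto simp: inj_on_def)
  have "(\<Sum>f\<in>monics (Suc n). F f) = (\<Sum>(a, g)\<in>UNIV \<times> monics n. F (pCons a g))"
    unfolding monics_Suc sum.reindex[OF inj] by (simp add: case_prod_unfold)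
  then show ?thesis by (simp add: sum.cartesian_product)
qed

lemma card_monics: "card (monics n :: 'a::{field,finite} poly set) = CARD('a) ^ n"
proof (induction n)
  case (Suc n)
  have "card (monics (Suc n) :: 'a poly set) = (\<Sum>f\<in>(monics (Suc n) :: 'a poly set). 1)" by simp
  also have "\<dots> = CARD('a) ^ Suc n" by (subst sum_monics_Suc) (simp add: Suc)
  finally show ?case .
qed (simp add: monics_0)

lemma monics_mult: "f \<in> monics m \<Longrightarrow> g \<in> monics n \<Longrightarrow> f * g \<in> monics (m + n)"
  by (auto simp: monics_def lead_coeff_mult)
     (metis degree_mult_eq leading_coeff_0_iff zero_neq_one)

lemma monics_power: "f \<in> monics m \<Longrightarrow> f ^ k \<in> monics (k * m)"
  by (induction k) (auto simp: monics_0 intro: monics_mult)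

lemma monics_dvdE:
  assumes f: "f \<in> monics n" and g: "g \<in> monics m" and dvd: "g dvd f"
  obtains h where "f = g * h" "h \<in> monics (n - m)" "m \<le> n"
proof -
  from dvd obtain h where h: "f = g * h" by (auto simp: dvd_def)
  have ne: "g \<noteq> 0" "h \<noteq> 0" using f g h by (auto simp: monics_def)
  have "lead_coeff h = 1" "n = m + degree h"
    using f g h degree_mult_eq[OF ne] by (auto simp: monics_def lead_coeff_mult)
  then show thesis using that[OF h] by (auto simp: monics_def)
qed

lemma monic_irreds_degree: "P \<in> monic_irreds \<Longrightarrow> degree P > 0"
  using is_unit_iff_degree[of P] by (cases "P = 0") (auto simp: monic_irreds_def irreducible_not_unit)

lemma monic_irreds_monics: "P \<in> monic_irreds \<Longrightarrow> P \<in> monics (degree P)"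
  by (auto simp: monic_irreds_def monics_def)

lemma finite_monic_irreds [simp]:
  "finite {P \<in> monic_irreds :: 'a::{field,finite} poly set. degree P \<le> n}"
proof (rule finite_subset)
  show "{P \<in> monic_irreds :: 'a poly set. degree P \<le> n} \<subseteq> (\<Union>k\<le>n. monics k)"
    by (auto simp: monic_irreds_def monics_def)
qed auto

section \<open>Factorization into monic irreducibles\<close>

lemma monic_irred_dvd_exists:
  assumes "degree (f :: 'a::field poly) > 0"
  obtains P where "P \<in> monic_irreds" "P dvd f"
  using assms
proof (induction "degree f" arbitrary: f thesis rule: less_induct)
  case less
  define g where "g = smult (inverse (lead_coeff f)) f"
  have f0: "f \<noteq> 0" using less.prems by auto
  then have g: "lead_coeff g = 1" "g dvd f" "degree g = degree f"
    by (auto simp: g_def smult_dvd_iff)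
  show ?case
  proof (cases "irreducible g")
    case True
    then show ?thesis using less.prems(1)[of g] g by (auto simp: monic_irreds_def)
  next
    case False
    moreover have "g \<noteq> 0" "\<not> is_unit g" using g less.prems f0
      by (auto simp: is_unit_iff_degree)
    ultimately obtain a b where ab: "g = a * b" "\<not> is_unit a" "\<not> is_unit b"
      by (auto simp: irreducible_def)
    then have ne: "a \<noteq> 0" "b \<noteq> 0" using \<open>g \<noteq> 0\<close> by auto
    then have "degree a > 0" "degree b > 0" using ab by (auto simp: is_unit_iff_degree)
    moreover have "degree f = degree a + degree b"
      using g ab degree_mult_eq[OF ne] by simp
    ultimately obtain P where "P \<in> monic_irreds" "P dvd a" using less.hyps[of a] by auto
    moreover have "a dvd f" using ab(1) g(2) by (metis dvd_mult_left)
    ultimately show ?thesis using less.prems(1)[of P] dvd_trans by blast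
  qed
qed

lemma monic_irreds_prime_elem: "P \<in> monic_irreds \<Longrightarrow> prime_elem P"
  by (auto simp: monic_irreds_def intro: field_poly_irreducible_imp_prime)

lemma monic_irreds_dvd_imp_eq:
  assumes P: "P \<in> monic_irreds" and Q: "Q \<in> monic_irreds" and dvd: "Q dvd P"
  shows "Q = P"
proof -
  obtain h where h: "P = Q * h" "h \<in> monics (degree P - degree Q)" "degree Q \<le> degree P"
    using monics_dvdE[OF monic_irreds_monics[OF P] monic_irreds_monics[OF Q] dvd] by blast
  have "\<not> is_unit Q" using Q by (auto simp: monic_irreds_def irreducible_not_unit)
  with P h(1) have "is_unit h" by (auto simp: monic_irreds_def dest: irreducibleD)
  then have "degree h = 0" using is_unit_iff_degree by (metis degree_0)
  moreover have "h \<in> monics (degree h)" using h(2) by (auto simp: monics_def)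
  ultimately have "h = 1" by (simp add: monics_0)
  with h show ?thesis by simp
qed

text \<open>Primality moves one factor \<open>q\<close> at a time into \<open>g\<close>. This is
  what keeps the multiplicity of \<open>q\<close> unchanged when a different prime is split
  off.\<close>

lemma prime_elem_power_dvd_multD:
  fixes q :: "'a::algebraic_semidom"
  assumes q: "prime_elem q" "\<not> q dvd p" and dvd: "q ^ k dvd p * g"
  shows "q ^ k dvd g"
  using dvd
proof (induction k arbitrary: g)
  case (Suc k)
  then have "q dvd p * g" by (auto dest: dvd_mult_left)
  then obtain h where h: "g = q * h" using q by (auto simp: prime_elem_dvd_mult_iff)
  then have "q * q ^ k dvd q * (p * h)" using Suc.prems by (simp add: mult_ac)
  then have "q ^ k dvd p * h" using q by (simp add: dvd_mult_cancel_left)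
  then have "q ^ k dvd h" by (rule Suc.IH)
  then show ?case unfolding h power_Suc by (rule mult_dvd_mono[OF dvd_refl])
qed simp

text \<open>The inner sum is the multiplicity of \<open>P\<close> in \<open>f\<close>, counted as
  the number of powers of \<open>P\<close> dividing it, so no explicit factorization is carried
  along. Splitting off one irreducible factor raises only its own multiplicity, by one. The separate
  cutoff \<open>n\<close> keeps the index sets fixed while the degree \<open>m\<close> drops in the
  induction.\<close>

lemma degree_eq_sum_prime_powers:
  fixes f :: "'a::{field,finite} poly"
  assumes "f \<in> monics m" "m \<le> n"
  shows "m = (\<Sum>P \<in> {P \<in> monic_irreds. degree P \<le> n}.
                degree P * (\<Sum>k=1..n. of_bool (P ^ k dvd f)))"
  using assms
proof (induction m arbitrary: f rule: less_induct)
  case (less m)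
  show ?case
  proof (cases "m = 0")
    case True
    then have "f = 1" using less.prems by (simp add: monics_0)
    moreover have "\<not> P ^ k dvd 1" if "P \<in> monic_irreds" "k > 0" for P :: "'a poly" and k
      using that by (auto simp: is_unit_power_iff monic_irreds_def irreducible_not_unit)
    ultimately show ?thesis using True by (auto intro!: sum.neutral)
  next
    case False
    then have "degree f > 0" using less.prems by (auto simp: monics_def)
    then obtain P where P: "P \<in> monic_irreds" "P dvd f" by (rule monic_irred_dvd_exists)
    then obtain g where g: "f = P * g" "g \<in> monics (m - degree P)" "degree P \<le> m"
      using monics_dvdE[OF less.prems(1) monic_irreds_monics] by blast
    have degP: "degree P > 0" by (rule monic_irreds_degree) fact
    have mult: "(\<Sum>k=1..n. of_bool (Q ^ k dvd f)) =
        (\<Sum>k=1..n. of_bool (Q ^ k dvd g)) + (if Q = P then 1 else (0::nat))"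
      if Q: "Q \<in> monic_irreds" for Q
    proof (cases "Q = P")
      case True
      \<comment> \<open>Shifting k by one turns the range 1..n into 0..n-1; the index n that gets
        lost contributes nothing, because \<open>g\<close> has degree below n.\<close>
      have "\<not> P ^ n dvd g"
      proof
        assume "P ^ n dvd g"
        then have "n * degree P \<le> m - degree P"
          using monics_dvdE[OF g(2) monics_power[OF monic_irreds_monics[OF P(1)]]] by blast
        moreover have "n \<le> n * degree P" using degP by simp
        ultimately show False using False degP less.prems(2) by linarith
      qed
      moreover obtain n' where n': "n = Suc n'" using False less.prems by (cases n) auto
      moreover have "P \<noteq> 0" using degP by auto
      moreover have "(\<Sum>k=1..n. of_bool (P ^ k dvd f)) = (\<Sum>k=0..n'. of_bool (P ^ k dvd g) :: nat)"
        unfolding n' using \<open>P \<noteq> 0\<close> by (simp only: One_nat_def sum.shift_bounds_cl_Suc_ivl g) simp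
      moreover have "\<dots> = 1 + (\<Sum>k=1..n'. of_bool (P ^ k dvd g))"
        by (subst sum.atLeast_Suc_atMost) auto
      ultimately show ?thesis using True by simp
    next
      case False
      then have "\<not> Q dvd P" using monic_irreds_dvd_imp_eq[OF P(1) Q] by auto
      then have "Q ^ k dvd f \<longleftrightarrow> Q ^ k dvd g" for k
        unfolding g(1)
        by (rule iffI[OF prime_elem_power_dvd_multD[OF monic_irreds_prime_elem[OF Q]] dvd_mult])
      then show ?thesis using False by simp
    qed
    have "(\<Sum>Q \<in> {P \<in> monic_irreds. degree P \<le> n}. degree Q * (\<Sum>k=1..n. of_bool (Q ^ k dvd f)))
        = (\<Sum>Q \<in> {P \<in> monic_irreds. degree P \<le> n}.
             degree Q * (\<Sum>k=1..n. of_bool (Q ^ k dvd g)) + (if Q = P then degree P else 0))"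
      by (intro sum.cong refl) (subst mult, auto simp: algebra_simps)
    also have "\<dots> = (m - degree P) + degree P"
      using less.IH[of "m - degree P" g] g P(1) less.prems degP
      by (simp add: sum.distrib sum.delta)
    finally show ?thesis using g by simp
  qed
qed

section \<open>Coefficients of the L-function and of its logarithmic derivative\<close>

definition monic_sum :: "('a::field poly \<Rightarrow> int) \<Rightarrow> nat \<Rightarrow> int" where
  "monic_sum \<psi> n = (\<Sum>f\<in>monics n. \<psi> f)"

text \<open>The coefficient of T^n in T L'(T) / L(T), where L is the generating series of
  \<open>monic_sum\<close>.\<close>

definition power_sum :: "('a::field poly \<Rightarrow> int) \<Rightarrow> nat \<Rightarrow> int" where
  "power_sum \<psi> n = (\<Sum>P | P \<in> monic_irreds \<and> degree P dvd n.
     int (degree P) * \<psi> P ^ (n div degree P))"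

definition monic_character :: "('a::field poly \<Rightarrow> int) \<Rightarrow> bool" where
  "monic_character \<psi> \<longleftrightarrow> \<psi> 1 = 1 \<and>
     (\<forall>f g. lead_coeff f = 1 \<longrightarrow> lead_coeff g = 1 \<longrightarrow> \<psi> (f * g) = \<psi> f * \<psi> g)"

lemma monic_character_power:
  assumes "monic_character \<psi>" "lead_coeff f = 1"
  shows "\<psi> (f ^ k) = \<psi> f ^ k"
proof (induction k)
  case (Suc k)
  have "lead_coeff (f ^ k) = 1" using assms(2) by (simp add: lead_coeff_power)
  then show ?case using assms Suc by (simp add: monic_character_def)
qed (use assms in \<open>simp add: monic_character_def\<close>)

lemma sum_multiples_of_power:
  fixes \<psi> :: "'a::{field,finite} poly \<Rightarrow> int"
  assumes \<psi>: "monic_character \<psi>" and P: "P \<in> monic_irreds"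
  shows "(\<Sum>f\<in>monics n. if P ^ k dvd f then \<psi> f else 0) =
    (if k * degree P \<le> n then \<psi> P ^ k * monic_sum \<psi> (n - k * degree P) else 0)"
proof -
  have Pk: "P ^ k \<in> monics (k * degree P)"
    using monic_irreds_monics[OF P] by (rule monics_power)
  have lam: "\<psi> (P ^ k * h) = \<psi> P ^ k * \<psi> h" if "lead_coeff h = 1" for h
  proof -
    have "lead_coeff (P ^ k) = 1" using Pk unfolding monics_def by blast
    then have "\<psi> (P ^ k * h) = \<psi> (P ^ k) * \<psi> h" using \<psi> that unfolding monic_character_def by blast
    also have "\<psi> (P ^ k) = \<psi> P ^ k"
      using P by (intro monic_character_power[OF \<psi>]) (simp add: monic_irreds_def)
    finally show ?thesis .
  qed
  have "(\<Sum>f\<in>monics n. if P ^ k dvd f then \<psi> f else 0) = (\<Sum>f | f \<in> monics n \<and> P ^ k dvd f. \<psi> f)"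
    by (rule sum.inter_filter[symmetric]) simp
  also have "\<dots> = (if k * degree P \<le> n then \<psi> P ^ k * monic_sum \<psi> (n - k * degree P) else 0)"
  proof (cases "k * degree P \<le> n")
    case True
    have "{f. f \<in> monics n \<and> P ^ k dvd f} = (\<lambda>h. P ^ k * h) ` monics (n - k * degree P)"
    proof (intro equalityI subsetI)
      fix f assume "f \<in> {f. f \<in> monics n \<and> P ^ k dvd f}"
      then show "f \<in> (\<lambda>h. P ^ k * h) ` monics (n - k * degree P)"
        using monics_dvdE[OF _ Pk] by blast
    next
      fix f assume "f \<in> (\<lambda>h. P ^ k * h) ` monics (n - k * degree P)"
      then obtain h where "f = P ^ k * h" "h \<in> monics (n - k * degree P)" by auto
      then show "f \<in> {f. f \<in> monics n \<and> P ^ k dvd f}"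
        using monics_mult[OF Pk, of h "n - k * degree P"] True by simp
    qed
    moreover have "inj_on (\<lambda>h. P ^ k * h) (monics (n - k * degree P))"
      using P by (auto simp: inj_on_def monic_irreds_def)
    ultimately have "(\<Sum>f | f \<in> monics n \<and> P ^ k dvd f. \<psi> f) =
        (\<Sum>h\<in>monics (n - k * degree P). \<psi> (P ^ k * h))"
      by (simp add: sum.reindex)
    also have "\<dots> = \<psi> P ^ k * monic_sum \<psi> (n - k * degree P)"
      unfolding monic_sum_def sum_distrib_left
      by (intro sum.cong refl lam) (auto simp: monics_def)
    finally show ?thesis using True by simp
  next
    case False
    have "{f. f \<in> monics n \<and> P ^ k dvd f} = {}"
      using False monics_dvdE[OF _ Pk] by blast
    then show ?thesis using False by (simp only: sum.empty if_False)
  qed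
  finally show ?thesis .
qed

text \<open>The logarithmic derivative of the Euler product, read off coefficientwise: both sides count
  pairs of a monic polynomial \<open>f\<close> and a prime power dividing it.\<close>

lemma newton_identity:
  fixes \<psi> :: "'a::{field,finite} poly \<Rightarrow> int"
  assumes \<psi>: "monic_character \<psi>"
  shows "int n * monic_sum \<psi> n = (\<Sum>j=1..n. power_sum \<psi> j * monic_sum \<psi> (n - j))"
proof -
  let ?I = "{P \<in> monic_irreds :: 'a poly set. degree P \<le> n}"
  let ?c = "monic_sum \<psi>"
  have "int n * ?c n = (\<Sum>f\<in>monics n. int n * \<psi> f)"
    by (simp add: monic_sum_def sum_distrib_left)
  also have "\<dots> = (\<Sum>f\<in>monics n. \<Sum>P\<in>?I. \<Sum>k=1..n.
      int (degree P) * (if P ^ k dvd f then \<psi> f else 0))"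
  proof (rule sum.cong[OF refl])
    fix f :: "'a poly" assume f: "f \<in> monics n"
    have "int n = (\<Sum>P\<in>?I. int (degree P) * (\<Sum>k=1..n. of_bool (P ^ k dvd f)))"
      by (subst degree_eq_sum_prime_powers[OF f order_refl]) simp
    then have "int n * \<psi> f = (\<Sum>P\<in>?I. int (degree P) * (\<Sum>k=1..n. of_bool (P ^ k dvd f))) * \<psi> f"
      by simp
    also have "\<dots> = (\<Sum>P\<in>?I. \<Sum>k=1..n. int (degree P) * (if P ^ k dvd f then \<psi> f else 0))"
      unfolding sum_distrib_left sum_distrib_right by (intro sum.cong refl) simp
    finally show "int n * \<psi> f = \<dots>" .
  qed
  also have "\<dots> = (\<Sum>P\<in>?I. \<Sum>k=1..n. \<Sum>f\<in>monics n.
      int (degree P) * (if P ^ k dvd f then \<psi> f else 0))"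
    by (subst sum.swap, intro sum.cong refl, rule sum.swap)
  also have "\<dots> = (\<Sum>P\<in>?I. \<Sum>k=1..n. if k * degree P \<le> n
      then int (degree P) * (\<psi> P ^ k * ?c (n - k * degree P)) else 0)"
    by (intro sum.cong refl, subst sum_distrib_left[symmetric], subst sum_multiples_of_power[OF \<psi>]) auto
  also have "\<dots> = (\<Sum>P\<in>?I. \<Sum>j=1..n. if degree P dvd j
      then int (degree P) * (\<psi> P ^ (j div degree P) * ?c (n - j)) else 0)"
  proof (rule sum.cong[OF refl])
    fix P assume P: "P \<in> ?I"
    then have d: "degree P > 0" using monic_irreds_degree by auto
    have filter: "(\<Sum>x=1..n. if R x then g x else 0) = (\<Sum>x | x \<in> {1..n} \<and> R x. g x)"
      for R and g :: "nat \<Rightarrow> int" by (rule sum.inter_filter[symmetric]) simp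
    \<comment> \<open>The power P^k belongs to the coefficient with index j = k deg P, its
      degree.\<close>
    have "(\<Sum>k | k \<in> {1..n} \<and> k * degree P \<le> n. int (degree P) * (\<psi> P ^ k * ?c (n - k * degree P))) =
       (\<Sum>j | j \<in> {1..n} \<and> degree P dvd j. int (degree P) * (\<psi> P ^ (j div degree P) * ?c (n - j)))"
      by (rule sum.reindex_bij_witness[of _ "\<lambda>j. j div degree P" "\<lambda>k. k * degree P"])
         (use d in \<open>auto simp: div_greater_zero_iff dvd_imp_le Suc_le_eq intro: le_trans[OF div_le_dividend]\<close>)
    then show "(\<Sum>k=1..n. if k * degree P \<le> n
      then int (degree P) * (\<psi> P ^ k * ?c (n - k * degree P)) else 0) = (\<Sum>j=1..n. if degree P dvd j
      then int (degree P) * (\<psi> P ^ (j div degree P) * ?c (n - j)) else 0)"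
      by (simp only: filter)
  qed
  also have "\<dots> = (\<Sum>j=1..n. \<Sum>P\<in>?I. if degree P dvd j
      then int (degree P) * (\<psi> P ^ (j div degree P) * ?c (n - j)) else 0)"
    by (rule sum.swap)
  also have "\<dots> = (\<Sum>j=1..n. power_sum \<psi> j * ?c (n - j))"
  proof (intro sum.cong refl)
    fix j assume j: "j \<in> {1..n}"
    have "{P \<in> ?I. degree P dvd j} = {P \<in> monic_irreds. degree P dvd j}"
      using j by (auto dest: dvd_imp_le)
    moreover have "(\<Sum>P\<in>?I. if degree P dvd j
      then int (degree P) * (\<psi> P ^ (j div degree P) * ?c (n - j)) else 0) =
      (\<Sum>P \<in> {P \<in> ?I. degree P dvd j}. int (degree P) * (\<psi> P ^ (j div degree P) * ?c (n - j)))"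
      by (rule sum.inter_filter[symmetric]) simp
    ultimately show "(\<Sum>P\<in>?I. if degree P dvd j
      then int (degree P) * (\<psi> P ^ (j div degree P) * ?c (n - j)) else 0) = power_sum \<psi> j * ?c (n - j)"
      by (simp add: power_sum_def sum_distrib_right mult.assoc)
  qed
  finally show ?thesis .
qed

section \<open>Additive characters and twisted sums\<close>

text \<open>Integer values suffice because a character of exponent 2 is a sign. The else branch
  means trace 1, by \<open>trace2_cases\<close>.\<close>

definition add_char :: "nat \<Rightarrow> 'a::field \<Rightarrow> int" where
  "add_char r x = (if trace2 r x = 0 then 1 else - 1)"

text \<open>For a monic \<open>f\<close> with roots \<open>x\<^sub>i\<close>, the value \<open>log_coeff f\<close> is \<open>- \<Sum> 1/x\<^sub>i\<close>, and
  \<open>log_coeff (reflect_poly f)\<close> is \<open>- \<Sum> x\<^sub>i\<close>.\<close>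

definition log_coeff :: "'a::field poly \<Rightarrow> 'a" where
  "log_coeff f = coeff f 1 / coeff f 0"

text \<open>Using \<open>reflect_poly\<close> makes both halves multiplicative for the same reason
  and gives the right value at the polynomial 1, where the coefficient with truncated index n - 1
  would be 1 instead of 0. Multiples of T get the value 0 even for u = v = 0, so all four twists see
  the same irreducibles.\<close>

definition twist :: "nat \<Rightarrow> 'a::field \<Rightarrow> 'a \<Rightarrow> 'a poly \<Rightarrow> int" where
  "twist r u v f = (if coeff f 0 = 0 then 0
     else add_char r (u * log_coeff (reflect_poly f) + v * log_coeff f))"

lemma log_coeff_mult:
  assumes "coeff f 0 \<noteq> 0" "coeff g 0 \<noteq> 0"
  shows "log_coeff (f * g) = log_coeff f + log_coeff g"
  using assms by (simp add: log_coeff_def coeff_mult field_simps)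

lemma log_coeff_reflect_monics:
  "f \<in> monics n \<Longrightarrow> n \<ge> 1 \<Longrightarrow> log_coeff (reflect_poly f) = coeff f (n - 1)"
  by (auto simp: log_coeff_def coeff_reflect_poly monics_def)

text \<open>When the L-function is at most quadratic, only the last three terms of the Newton
  identity survive, and its left side vanishes from degree 3 on.\<close>

lemma newton_recurrence:
  fixes \<psi> :: "'a::{field,finite} poly \<Rightarrow> int"
  assumes "monic_character \<psi>" and zero: "\<And>n. n \<ge> 3 \<Longrightarrow> monic_sum \<psi> n = 0"
  shows "power_sum \<psi> 1 = monic_sum \<psi> 1"
    and "power_sum \<psi> 2 = 2 * monic_sum \<psi> 2 - monic_sum \<psi> 1 ^ 2"
    and "power_sum \<psi> (n + 3) =
           - monic_sum \<psi> 1 * power_sum \<psi> (n + 2) - monic_sum \<psi> 2 * power_sum \<psi> (n + 1)"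
proof -
  have c0: "monic_sum \<psi> 0 = 1"
    using assms(1) by (simp add: monic_sum_def monics_0 monic_character_def)
  note newton = newton_identity[OF assms(1)]
  show 1: "power_sum \<psi> 1 = monic_sum \<psi> 1" using newton[of 1] c0 by simp
  have "{1..2::nat} = {1, 2}" by auto
  then show "power_sum \<psi> 2 = 2 * monic_sum \<psi> 2 - monic_sum \<psi> 1 ^ 2"
    using newton[of 2] c0 1 by (simp add: power2_eq_square)
  have "(\<Sum>j=1..n + 3. power_sum \<psi> j * monic_sum \<psi> (n + 3 - j)) =
        (\<Sum>j\<in>{n + 1, n + 2, n + 3}. power_sum \<psi> j * monic_sum \<psi> (n + 3 - j))"
  proof (rule sum.mono_neutral_right)
    show "\<forall>j\<in>{1..n + 3} - {n + 1, n + 2, n + 3}. power_sum \<psi> j * monic_sum \<psi> (n + 3 - j) = 0"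
    proof
      fix j assume "j \<in> {1..n + 3} - {n + 1, n + 2, n + 3}"
      then have "n + 3 - j \<ge> 3" by auto
      then show "power_sum \<psi> j * monic_sum \<psi> (n + 3 - j) = 0" by (simp add: zero)
    qed
  qed auto
  then show "power_sum \<psi> (n + 3) =
      - monic_sum \<psi> 1 * power_sum \<psi> (n + 2) - monic_sum \<psi> 2 * power_sum \<psi> (n + 1)"
    using newton[of "n + 3"] c0 zero[of "n + 3"] by (simp add: algebra_simps)
qed

text \<open>The L-function is (1 - aT)(1 - bT), and - (a^n + b^n) has the same initial values and
  recurrence as the power sums. Taking b = 0 covers linear L-functions.\<close>

lemma power_sum_quadratic:
  fixes \<psi> :: "'a::{field,finite} poly \<Rightarrow> int" and a b :: complex
  assumes "monic_character \<psi>" "\<And>n. n \<ge> 3 \<Longrightarrow> monic_sum \<psi> n = 0"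
    and c1: "of_int (monic_sum \<psi> 1) = - (a + b)" and c2: "of_int (monic_sum \<psi> 2) = a * b"
    and "n \<ge> 1"
  shows "of_int (power_sum \<psi> n) = - (a ^ n + b ^ n)"
  using \<open>n \<ge> 1\<close>
proof (induction n rule: less_induct)
  case (less n)
  note rec = newton_recurrence[OF assms(1,2)]
  consider "n = 1" | "n = 2" | m where "n = m + 3"
  proof (cases "n \<le> 2")
    case False
    then have "n = (n - 3) + 3" by simp
    then show thesis using that(3) by blast
  qed (use less.prems that in force)
  then show ?case
  proof cases
    case 1
    then show ?thesis using rec(1) c1 by simp
  next
    case 2
    have "of_int (power_sum \<psi> 2) = 2 * (a * b) - (- (a + b)) ^ 2"
      by (simp only: rec(2) of_int_diff of_int_mult of_int_power of_int_numeral c1 c2)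
    then show ?thesis using 2 by (simp add: power2_eq_square algebra_simps)
  next
    case (3 m)
    have "of_int (power_sum \<psi> n) = (a + b) * of_int (power_sum \<psi> (m + 2))
        - a * b * of_int (power_sum \<psi> (m + 1))"
      by (simp only: 3 rec(3) of_int_diff of_int_mult of_int_minus c1 c2 minus_minus)
    also have "of_int (power_sum \<psi> (m + 2)) = - (a ^ (m + 2) + b ^ (m + 2))"
      using 3 by (intro less.IH) auto
    also have "of_int (power_sum \<psi> (m + 1)) = - (a ^ (m + 1) + b ^ (m + 1))"
      using 3 by (intro less.IH) auto
    also have "(a + b) * - (a ^ (m + 2) + b ^ (m + 2)) - a * b * - (a ^ (m + 1) + b ^ (m + 1))
        = - (a ^ n + b ^ n)"
      by (simp add: 3 algebra_simps power_add power2_eq_square power3_eq_cube)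
    finally show ?thesis .
  qed
qed

section \<open>Trace and additive character; applied both to the given field and to the field with
  two elements\<close>

locale binary_field =
  fixes r :: nat and ty :: "'a::{field,finite} itself"
  assumes r_pos: "r \<ge> 1" and card_field: "CARD('a) = 2 ^ r"
begin

text \<open>Translation by 1 permutes the field, so adding 1 to every element leaves the sum of all
  elements unchanged.\<close>

lemma of_nat_card_eq_0: "of_nat CARD('a) = (0 :: 'a)"
proof -
  have "(\<Sum>x\<in>UNIV. x :: 'a) = (\<Sum>x\<in>UNIV. x + 1)"
    by (rule sum.reindex_bij_witness[of _ "\<lambda>x. x + 1" "\<lambda>x. x - 1"]) auto
  then show ?thesis by (simp add: sum.distrib)
qed

lemma char_2: "CHAR('a) = 2"
proof -
  have "CHAR('a) dvd 2 ^ r"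
    using of_nat_card_eq_0 by (simp only: of_nat_eq_0_iff_char_dvd card_field)
  moreover have "prime CHAR('a)"
    by (intro prime_CHAR_semidom finite_imp_CHAR_pos) simp
  ultimately show ?thesis
    using primes_dvd_imp_eq prime_dvd_power two_is_prime_nat by blast
qed

lemma two_eq_0: "(2 :: 'a) = 0"
  using of_nat_CHAR[where ?'a = 'a] by (simp add: char_2)

lemma add_self: "(x :: 'a) + x = 0"
  using two_eq_0 by (metis mult_2 mult_zero_left)

lemma uminus_eq: "- (x :: 'a) = x"
  using add_self by (metis add_eq_0_iff)

lemma frobenius_add: "(x + y :: 'a) ^ (2 ^ i) = x ^ (2 ^ i) + y ^ (2 ^ i)"
  by (rule freshmans_dream') (simp_all add: char_2)

lemma frobenius_sum: "(\<Sum>i\<in>A. f i :: 'a) ^ (2 ^ k) = (\<Sum>i\<in>A. f i ^ (2 ^ k))"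
  by (rule freshmans_dream_sum') (simp_all add: char_2)

text \<open>Multiplication by a nonzero \<open>x\<close> permutes the nonzero elements; compare
  their products.\<close>

lemma power_card: "(x :: 'a) ^ (2 ^ r) = x"
proof (cases "x = 0")
  case False
  have "(\<Prod>y\<in>UNIV - {0}. x * y) = (\<Prod>y\<in>UNIV - {0 :: 'a}. y)"
    by (rule prod.reindex_bij_witness[of _ "\<lambda>y. y / x" "\<lambda>y. x * y"]) (use False in auto)
  moreover have "(\<Prod>y\<in>UNIV - {0}. x * y) = x ^ (2 ^ r - 1) * (\<Prod>y\<in>UNIV - {0}. y)"
    by (simp add: prod.distrib card_Diff_singleton card_field)
  ultimately have "x ^ (2 ^ r - 1) = 1" by simp
  moreover have "x ^ (2 ^ r) = x * x ^ (2 ^ r - 1)"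
    by (metis power_eq_if power_not_zero zero_neq_numeral)
  ultimately show ?thesis by simp
qed simp

lemma trace2_add: "trace2 d (x + y :: 'a) = trace2 d x + trace2 d y"
  by (simp add: trace2_def frobenius_add sum.distrib)

text \<open>Squaring permutes the conjugates cyclically, so the trace is a root of X^2 - X.\<close>

lemma trace2_cases: "trace2 r (x :: 'a) = 0 \<or> trace2 r x = 1"
proof -
  obtain s where s: "r = Suc s" using r_pos by (cases r) auto
  have "trace2 r x ^ 2 = (\<Sum>i<r. x ^ (2 ^ Suc i))"
    using frobenius_sum[of "\<lambda>i. x ^ (2 ^ i)" "{..<r}" 1]
    by (simp add: trace2_def power_mult[symmetric] mult.commute)
  also have "\<dots> = x ^ (2 ^ r) + (\<Sum>i<s. x ^ (2 ^ Suc i))"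
    unfolding s by (simp only: sum.lessThan_Suc add.commute)
  also have "\<dots> = trace2 r x"
    using power_card[of x] unfolding trace2_def s sum.lessThan_Suc_shift by simp
  finally have "trace2 r x * (trace2 r x - 1) = 0" by (simp add: power2_eq_square algebra_simps)
  then show ?thesis by simp
qed

lemma trace2_eq_1_iff: "trace2 r (x :: 'a) = 1 \<longleftrightarrow> add_char r x = - 1"
  using trace2_cases[of x] by (auto simp: add_char_def)

text \<open>The trace is given by a nonzero polynomial of degree at most 2^(r-1), too small to
  vanish on all 2^r elements.\<close>

lemma trace2_surj: "\<exists>c :: 'a. trace2 r c = 1"
proof -
  define p :: "'a poly" where "p = (\<Sum>i<r. monom 1 (2 ^ i))"
  have poly_p: "poly p x = trace2 r x" for x
    by (simp add: p_def trace2_def poly_sum poly_monom)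
  have "degree p \<le> 2 ^ (r - 1)"
    unfolding p_def by (rule degree_sum_le) (auto simp: degree_monom_eq)
  have "coeff p 1 = (\<Sum>i<r. if i = 0 then 1 else 0)"
    unfolding p_def coeff_sum by (intro sum.cong) auto
  then have "coeff p 1 = 1" using r_pos by simp
  then have "p \<noteq> 0" by auto
  have "card {x. poly p x = 0} \<le> degree p" by (rule card_poly_roots_bound) fact
  also have "\<dots> < CARD('a)"
    using \<open>degree p \<le> _\<close> r_pos unfolding card_field
    by (elim le_less_trans) simp
  finally have "{x. poly p x = 0} \<noteq> UNIV" by auto
  then show ?thesis using trace2_cases by (auto simp: poly_p)
qed

lemma add_char_add: "add_char r (x + y :: 'a) = add_char r x * add_char r y"
  using trace2_cases[of x] trace2_cases[of y] add_self[of 1]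
  by (auto simp: add_char_def trace2_add)

lemma add_char_0 [simp]: "add_char r (0 :: 'a) = 1"
  using r_pos by (simp add: add_char_def trace2_def power_0_left)

lemma add_char_cases: "add_char r (x :: 'a) = 1 \<or> add_char r x = - 1"
  by (auto simp: add_char_def)

lemma add_char_minus_1_exists:
  assumes "(a :: 'a) \<noteq> 0" obtains c where "add_char r (a * c) = - 1"
proof -
  obtain c :: 'a where "trace2 r c = 1" using trace2_surj by blast
  then have "add_char r (a * (c / a)) = - 1" using assms by (simp add: add_char_def)
  then show thesis by (rule that)
qed

lemma sum_add_char:
  "(\<Sum>x\<in>UNIV. add_char r (a * x :: 'a)) = (if a = 0 then int CARD('a) else 0)"
proof (cases "a = 0")
  case False
  then obtain c where c: "add_char r (a * c) = - 1" by (rule add_char_minus_1_exists)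
  have "(\<Sum>x\<in>UNIV. add_char r (a * x)) = (\<Sum>x\<in>UNIV. add_char r (a * (x + c)))"
    by (rule sum.reindex_bij_witness[of _ "\<lambda>x. x + c" "\<lambda>x. x - c"]) auto
  also have "\<dots> = - (\<Sum>x\<in>UNIV. add_char r (a * x))"
    by (simp add: distrib_left add_char_add c sum_negf)
  finally show ?thesis using False by simp
qed simp

section \<open>The L-functions of the twists\<close>

lemma monic_character_twist: "monic_character (twist r (u :: 'a) v)"
  unfolding monic_character_def
proof (intro conjI allI impI)
  show "twist r u v 1 = 1" by (simp add: twist_def log_coeff_def)
next
  fix f g :: "'a poly" assume "lead_coeff f = 1" "lead_coeff g = 1"
  moreover have "coeff (f * g) 0 = coeff f 0 * coeff g 0" by (simp add: coeff_mult)
  moreover have "u * (a + b) + v * (c + d) = (u * a + v * c) + (u * b + v * d)" for a b c d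
    by (simp add: algebra_simps)
  ultimately show "twist r u v (f * g) = twist r u v f * twist r u v g"
    by (auto simp: twist_def reflect_poly_mult log_coeff_mult simp flip: add_char_add)
qed

lemma monics_shift:
  assumes f: "(f :: 'a poly) \<in> monics n" and "i < n"
  shows "f + monom c i \<in> monics n"
proof -
  have deg: "degree (monom c i) < degree f"
    using assms degree_monom_le[of c i] by (auto simp: monics_def)
  then have "degree (f + monom c i) = degree f" by (rule degree_add_eq_left)
  then show ?thesis using f assms(2) by (auto simp: monics_def)
qed

text \<open>The shift by \<open>c f\<close> is an involution, as x + x = 0 and \<open>c\<close> does
  not change under it; it pairs summands of opposite sign.\<close>

lemma monic_sum_shift_eq_0:
  fixes u v :: 'a and c :: "'a poly \<Rightarrow> 'a"
  assumes "i < n" "\<And>f. f \<in> monics n \<Longrightarrow> c (f + monom (c f) i) = c f"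
    and "\<And>f. f \<in> monics n \<Longrightarrow> twist r u v (f + monom (c f) i) = - twist r u v f"
  shows "monic_sum (twist r u v) n = 0"
proof -
  have "monic_sum (twist r u v) n = (\<Sum>f\<in>monics n. twist r u v (f + monom (c f) i))"
    unfolding monic_sum_def
    by (rule sum.reindex_bij_witness[of _ "\<lambda>f. f + monom (c f) i" "\<lambda>f. f + monom (c f) i"])
       (use assms(1,2) in \<open>auto intro: monics_shift simp: add.assoc add_monom add_self\<close>)
  also have "\<dots> = - monic_sum (twist r u v) n"
    by (simp add: assms(3) monic_sum_def sum_negf)
  finally show ?thesis by simp
qed

text \<open>Only the linear coefficient is shifted. For n \<ge> 3 it is not the subleading one, so
  the sum of the roots stays put; for n = 2 the two coincide, which is harmless only when u =
  0.\<close>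

lemma monic_sum_eq_0_right:
  fixes u v :: 'a
  assumes "v \<noteq> 0" "n \<ge> 3 \<or> n = 2 \<and> u = 0"
  shows "monic_sum (twist r u v) n = 0"
proof -
  obtain c where c: "add_char r (v * c) = - 1" using add_char_minus_1_exists[OF assms(1)] .
  show ?thesis
  \<comment> \<open>The factor \<open>coeff f 0\<close> cancels the denominator, so
    \<open>log_coeff\<close> changes by exactly \<open>c\<close>.\<close>
  proof (rule monic_sum_shift_eq_0[of 1 n "\<lambda>f. c * coeff f 0"])
    fix f :: "'a poly" assume f: "f \<in> monics n"
    let ?g = "f + monom (c * coeff f 0) 1"
    have g: "?g \<in> monics n" using f assms by (intro monics_shift) auto
    have s: "u * log_coeff (reflect_poly ?g) = u * log_coeff (reflect_poly f)"
    proof (cases "u = 0")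
      case False
      then have "n - 1 \<noteq> 1" using assms by auto
      then show ?thesis using f g assms by (auto simp: log_coeff_reflect_monics)
    qed simp
    show "twist r u v ?g = - twist r u v f"
    proof (cases "coeff f 0 = 0")
      case False
      then have t: "log_coeff ?g = log_coeff f + c" by (simp add: log_coeff_def field_simps)
      have c0: "coeff ?g 0 = coeff f 0" by simp
      show ?thesis
        unfolding twist_def s t c0 using c by (simp add: distrib_left add_char_add)
    qed (simp add: twist_def)
  qed (use assms in auto)
qed

lemma monic_sum_eq_0_left:
  fixes u v :: 'a
  assumes "u \<noteq> 0" "n \<ge> 3 \<or> n = 2 \<and> v = 0"
  shows "monic_sum (twist r u v) n = 0"
proof -
  obtain c where c: "add_char r (u * c) = - 1" using add_char_minus_1_exists[OF assms(1)] .
  show ?thesis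
  proof (rule monic_sum_shift_eq_0[of "n - 1" n "\<lambda>f. c"])
    fix f :: "'a poly" assume f: "f \<in> monics n"
    let ?g = "f + monom c (n - 1)"
    have g: "?g \<in> monics n" using f assms by (intro monics_shift) auto
    have c0: "coeff ?g 0 = coeff f 0" using assms by auto
    have t: "v * log_coeff ?g = v * log_coeff f" using assms by (auto simp: log_coeff_def)
    have s: "log_coeff (reflect_poly ?g) = log_coeff (reflect_poly f) + c"
      using f g assms by (auto simp: log_coeff_reflect_monics)
    have "add_char r (u * (a + c) + b) = - add_char r (u * a + b)" for a b
      using c by (simp add: distrib_left add_char_add)
    then show "twist r u v ?g = - twist r u v f"
      unfolding twist_def c0 s t by simp
  qed (use assms in auto)
qed

lemma monic_sum_1: "monic_sum (twist r u v) 1 = (\<Sum>a\<in>UNIV - {0 :: 'a}. add_char r (u * a + v / a))"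
proof -
  have "monic_sum (twist r u v) 1 = (\<Sum>a\<in>UNIV. twist r u v [:a, 1:])"
    unfolding monic_sum_def One_nat_def sum_monics_Suc by (simp add: monics_0 one_pCons)
  also have "\<dots> = (\<Sum>a\<in>UNIV. if a \<noteq> 0 then add_char r (u * a + v / a) else 0)"
    by (intro sum.cong refl) (simp add: twist_def log_coeff_def coeff_reflect_poly)
  also have "\<dots> = (\<Sum>a\<in>UNIV - {0 :: 'a}. add_char r (u * a + v / a))"
    by (simp add: sum.If_cases) (simp add: Compl_eq_Diff_UNIV Collect_neg_eq)
  finally show ?thesis .
qed

definition kloosterman :: int where
  "kloosterman = (\<Sum>a\<in>UNIV - {0 :: 'a}. add_char r (a + 1 / a))"

lemma monic_sum_twist_1:
  "monic_sum (twist r (1 :: 'a) 1) 1 = kloosterman"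
  "monic_sum (twist r (1 :: 'a) 0) 1 = - 1"
  "monic_sum (twist r (0 :: 'a) 1) 1 = - 1"
proof -
  have "(\<Sum>a\<in>UNIV. add_char r (a :: 'a)) = 0" using sum_add_char[of 1] by simp
  then have s: "(\<Sum>a\<in>UNIV - {0}. add_char r (a :: 'a)) = - 1"
    by (simp add: sum_diff1)
  show "monic_sum (twist r (1 :: 'a) 1) 1 = kloosterman"
    unfolding monic_sum_1 kloosterman_def by simp
  show "monic_sum (twist r (1 :: 'a) 0) 1 = - 1" unfolding monic_sum_1 using s by simp
  have "(\<Sum>a\<in>UNIV - {0}. add_char r (1 / a :: 'a)) = (\<Sum>a\<in>UNIV - {0}. add_char r (a :: 'a))"
    by (rule sum.reindex_bij_witness[of _ "\<lambda>a. 1 / a" "\<lambda>a. 1 / a"]) auto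
  then show "monic_sum (twist r (0 :: 'a) 1) 1 = - 1" unfolding monic_sum_1 using s by simp
qed

text \<open>On T^2 + bT + a with nonzero a the twist is the character at (1 + 1/a) b, so the sum
  over b is zero unless a = 1, where it is q.\<close>

lemma monic_sum_twist_2: "monic_sum (twist r (1 :: 'a) 1) 2 = int CARD('a)"
proof -
  have "monic_sum (twist r (1 :: 'a) 1) 2 = (\<Sum>a\<in>UNIV. \<Sum>b\<in>UNIV. twist r 1 1 [:a :: 'a, b, 1:])"
    unfolding monic_sum_def numeral_2_eq_2 sum_monics_Suc by (simp add: monics_0 one_pCons)
  also have "\<dots> = (\<Sum>a\<in>UNIV. if a = (1 :: 'a) then int CARD('a) else 0)"
  proof (intro sum.cong refl)
    fix a :: 'a
    show "(\<Sum>b\<in>UNIV. twist r 1 1 [:a, b, 1:]) = (if a = 1 then int CARD('a) else 0)"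
    proof (cases "a = 0")
      case False
      have "(\<Sum>b\<in>UNIV. twist r 1 1 [:a, b, 1:]) = (\<Sum>b\<in>UNIV. add_char r ((1 + 1 / a) * b))"
        using False
        by (intro sum.cong refl)
           (simp add: twist_def log_coeff_def coeff_reflect_poly numeral_2_eq_2 field_simps)
      moreover have "1 + 1 / a = 0 \<longleftrightarrow> a = 1"
        using False uminus_eq[of 1] by (auto simp: field_simps add_eq_0_iff add_self)
      ultimately show ?thesis by (simp only: sum_add_char)
    qed (simp add: twist_def)
  qed
  finally show ?thesis by simp
qed

text \<open>Here the coefficients q^n - q^(n-1) never vanish, and the L-function (1 - T)/(1 - qT) is
  not a polynomial, so the Newton identity is solved directly.\<close>

lemma power_sum_twist_0_0:
  assumes "n \<ge> 1" shows "power_sum (twist r (0 :: 'a) 0) n = int CARD('a) ^ n - 1"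
  using assms
proof (induction n rule: less_induct)
  case (less n)
  obtain m where m: "n = Suc m" using less.prems by (cases n) auto
  let ?q = "int CARD('a)" and ?c = "monic_sum (twist r (0 :: 'a) 0)"
  have c0: "?c 0 = 1" by (simp add: monic_sum_def monics_0 twist_def)
  have c: "?c (Suc k) = ?q ^ Suc k - ?q ^ k" for k
  proof -
    have "?c (Suc k) = (\<Sum>a\<in>UNIV. if a \<noteq> (0 :: 'a) then ?q ^ k else 0)"
      unfolding monic_sum_def sum_monics_Suc
      by (intro sum.cong refl) (simp add: twist_def card_monics)
    also have "\<dots> = (\<Sum>a\<in>UNIV - {0 :: 'a}. ?q ^ k)"
      by (simp add: sum.If_cases) (simp add: Compl_eq_Diff_UNIV Collect_neg_eq)
    also have "\<dots> = (?q - 1) * ?q ^ k"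
      using finite_UNIV_card_ge_0[where ?'a = 'a]
      by (simp add: card_Diff_singleton of_nat_diff)
    finally show ?thesis by (simp add: algebra_simps)
  qed
  \<comment> \<open>Each product splits into a part independent of j and a difference that
    telescopes.\<close>
  have "(\<Sum>j<m. power_sum (twist r (0 :: 'a) 0) (Suc j) * ?c (m - j)) =
      (\<Sum>j<m. (?q ^ Suc m - ?q ^ m) - (?q ^ (m - j) - ?q ^ (m - Suc j)))"
  proof (intro sum.cong refl)
    fix j assume "j \<in> {..<m}"
    then obtain i where i: "m = Suc (j + i)" by (auto simp: less_iff_Suc_add)
    have p: "power_sum (twist r (0 :: 'a) 0) (Suc j) = ?q ^ Suc j - 1"
      using less.IH[of "Suc j"] i m by simp
    show "power_sum (twist r (0 :: 'a) 0) (Suc j) * ?c (m - j) =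
        (?q ^ Suc m - ?q ^ m) - (?q ^ (m - j) - ?q ^ (m - Suc j))"
      unfolding p using i by (simp add: c Suc_diff_le algebra_simps power_add)
  qed
  also have "\<dots> = int m * (?q ^ Suc m - ?q ^ m) - (?q ^ m - 1)"
    by (subst sum_subtractf) (simp only: sum_lessThan_telescope'[of "\<lambda>j. ?q ^ (m - j)" m], simp)
  finally have "(\<Sum>j<m. power_sum (twist r (0 :: 'a) 0) (Suc j) * ?c (m - j)) = \<dots>" .
  moreover have "int n * ?c n = (\<Sum>j<m. power_sum (twist r (0 :: 'a) 0) (Suc j) * ?c (m - j))
      + power_sum (twist r (0 :: 'a) 0) n"
    unfolding newton_identity[OF monic_character_twist] m One_nat_def sum.atLeast1_atMost_eq
    by (simp add: c0)
  ultimately show ?case unfolding m c by (simp add: algebra_simps)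
qed

text \<open>The L-function is 1 - T, with 1 and 0 in the role of reciprocal roots.\<close>

lemma power_sum_twist_left:
  assumes "n \<ge> 1" shows "power_sum (twist r (1 :: 'a) 0) n = - 1"
proof -
  have "of_int (power_sum (twist r (1 :: 'a) 0) n) = - (1 ^ n + 0 ^ n :: complex)"
    using assms
    by (intro power_sum_quadratic monic_character_twist)
       (auto simp: monic_sum_eq_0_left monic_sum_twist_1[simplified])
  also have "\<dots> = of_int (- 1)" using assms by simp
  finally show ?thesis by (simp only: of_int_eq_iff)
qed

lemma power_sum_twist_right:
  assumes "n \<ge> 1" shows "power_sum (twist r (0 :: 'a) 1) n = - 1"
proof -
  have "of_int (power_sum (twist r (0 :: 'a) 1) n) = - (1 ^ n + 0 ^ n :: complex)"
    using assms
    by (intro power_sum_quadratic monic_character_twist)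
       (auto simp: monic_sum_eq_0_right monic_sum_twist_1[simplified])
  also have "\<dots> = of_int (- 1)" using assms by simp
  finally show ?thesis by (simp only: of_int_eq_iff)
qed

lemma power_sum_twist_both:
  assumes "n \<ge> 1" "a + b = - of_int kloosterman" "a * b = of_nat CARD('a)"
  shows "of_int (power_sum (twist r (1 :: 'a) 1) n) = - (a ^ n + b ^ n :: complex)"
  using assms
  by (intro power_sum_quadratic monic_character_twist)
     (auto simp: monic_sum_eq_0_right monic_sum_twist_1[simplified] monic_sum_twist_2)

end

section \<open>Descent to the prime field\<close>

text \<open>Serves two ring maps: the embedding of the prime field and the squaring of
  coefficients.\<close>

lemma map_poly_mult:
  fixes h :: "'a::comm_semiring_0 \<Rightarrow> 'b::comm_semiring_0"
  assumes "h 0 = 0" "\<And>a b. h (a + b) = h a + h b" "\<And>a b. h (a * b) = h a * h b"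
  shows "map_poly h (p * q) = map_poly h p * map_poly h q"
proof (rule poly_eqI)
  have sum: "h (\<Sum>i\<in>A. f i) = (\<Sum>i\<in>A. h (f i))" for A :: "nat set" and f
    by (induction A rule: infinite_finite_induct) (auto simp: assms)
  show "coeff (map_poly h (p * q)) n = coeff (map_poly h p * map_poly h q) n" for n
    by (simp add: coeff_map_poly assms coeff_mult sum)
qed

lemma log_coeff_prod:
  assumes "finite A" "\<And>i. i \<in> A \<Longrightarrow> coeff (f i) 0 \<noteq> 0"
  shows "log_coeff (\<Prod>i\<in>A. f i) = (\<Sum>i\<in>A. log_coeff (f i))"
    and "coeff (\<Prod>i\<in>A. f i) 0 \<noteq> 0"
  using assms
  by (induction A rule: finite_induct) (auto simp: log_coeff_mult, auto simp: log_coeff_def coeff_mult)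

section \<open>The field with two elements and the numbers alpha\<close>

lemma gf2_cases: "(x :: gf2) = 0 \<or> x = 1"
  by transfer auto

lemma gf2_two_eq_0: "(2 :: gf2) = 0"
proof -
  have "(1 :: gf2) + 1 = 0" by transfer auto
  then show ?thesis by simp
qed

lemma UNIV_gf2: "(UNIV :: gf2 set) = {0, 1}"
  using gf2_cases by auto

lemma binary_field_gf2: "binary_field TYPE(gf2) 1"
  by standard (simp_all add: UNIV_gf2)

lemma add_char_gf2: "add_char (Suc 0) (x :: gf2) = (if x = 0 then 1 else - 1)"
  by (simp add: add_char_def trace2_def)

lemma kloosterman_gf2: "binary_field.kloosterman TYPE(gf2) 1 = 1"
proof -
  have "UNIV - {0} = {1 :: gf2}" by (auto simp: UNIV_gf2)
  then show ?thesis
    unfolding binary_field.kloosterman_def[OF binary_field_gf2]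
    by (simp add: add_char_gf2 gf2_two_eq_0)
qed

lemma alpha_alt: "alpha = Complex (- 1 / 2) (sqrt 7 / 2)"
proof -
  have "csqrt (- 7) = \<i> * of_real (sqrt 7)"
    by (subst csqrt_of_real_nonpos) auto
  then show ?thesis by (simp add: alpha_def complex_eq_iff)
qed

lemma alpha_add_cnj: "alpha + cnj alpha = - 1"
  by (simp add: alpha_alt complex_eq_iff)

lemma alpha_mult_cnj: "alpha * cnj alpha = 2"
  by (simp add: alpha_alt complex_eq_iff)

lemma norm_alpha: "cmod alpha = sqrt 2"
  by (simp add: alpha_alt cmod_def power_divide)

lemma power_sum_gf2:
  assumes "n \<ge> 1"
  shows "of_int (power_sum (twist 1 (1 :: gf2) 1) n) = - (alpha ^ n + cnj alpha ^ n)"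
  by (rule binary_field.power_sum_twist_both[OF binary_field_gf2 assms])
     (simp_all add: kloosterman_gf2[simplified] alpha_add_cnj alpha_mult_cnj UNIV_gf2)

section \<open>Frobenius orbits and minimal polynomials over the prime field\<close>

context binary_field
begin

definition emb :: "gf2 \<Rightarrow> 'a" where
  "emb x = (if x = 0 then 0 else 1)"

lemma emb_simps [simp]:
  "emb 0 = 0" "emb 1 = 1" "emb (a + b) = emb a + emb b" "emb (a * b) = emb a * emb b"
  "emb (a / b) = emb a / emb b" "emb a = 0 \<longleftrightarrow> a = 0"
  using gf2_cases[of a] gf2_cases[of b] add_self[of 1] by (auto simp: emb_def gf2_two_eq_0 two_eq_0)

lemma emb_square: "emb a ^ 2 = emb a"
  by (simp add: emb_def)

abbreviation emb_poly :: "gf2 poly \<Rightarrow> 'a poly" where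
  "emb_poly \<equiv> map_poly emb"

lemma emb_poly_mult: "emb_poly (p * q) = emb_poly p * emb_poly q"
  by (rule map_poly_mult) auto

lemma degree_emb_poly [simp]: "degree (emb_poly p) = degree p"
  by (rule degree_map_poly) auto

lemma emb_log_coeff: "log_coeff (emb_poly p) = emb (log_coeff p)"
  by (simp add: log_coeff_def coeff_map_poly)

lemma emb_reflect_poly: "reflect_poly (emb_poly p) = emb_poly (reflect_poly p)"
  by (rule poly_eqI) (simp add: coeff_reflect_poly coeff_map_poly)

text \<open>Squaring fixes the coefficients, so it commutes with evaluation and maps roots to
  roots.\<close>

lemma emb_poly_root_frobenius:
  assumes "poly (emb_poly p) x = 0" shows "poly (emb_poly p) (x ^ (2 ^ i)) = 0"
proof (induction i)
  case (Suc i)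
  have "poly (emb_poly p) (y ^ 2) = poly (emb_poly p) y ^ 2" for y
  proof -
    have "poly (emb_poly p) (y ^ 2) = (\<Sum>j\<le>degree p. (coeff (emb_poly p) j * y ^ j) ^ 2)"
      by (simp add: poly_altdef coeff_map_poly emb_square power_mult_distrib
          power_mult[symmetric] mult.commute)
    also have "\<dots> = poly (emb_poly p) y ^ 2"
      using frobenius_sum[of "\<lambda>j. coeff (emb_poly p) j * y ^ j" "{..degree p}" 1]
      by (simp add: poly_altdef)
    finally show ?thesis .
  qed
  from this[of "x ^ (2 ^ i)"] show ?case
    using Suc by (simp add: power_mult[symmetric] mult.commute)
qed (use assms in simp)

definition period :: "'a \<Rightarrow> nat" where
  "period x = (LEAST d. d \<ge> 1 \<and> x ^ (2 ^ d) = x)"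

lemma period: "period x \<ge> 1" "x ^ (2 ^ period x) = x"
  using LeastI[of "\<lambda>d. d \<ge> 1 \<and> x ^ (2 ^ d) = x" r] r_pos power_card
  by (auto simp: period_def)

lemma period_minimal: "d \<ge> 1 \<Longrightarrow> x ^ (2 ^ d) = x \<Longrightarrow> period x \<le> d"
  unfolding period_def by (rule Least_le) simp

lemma frobenius_period_mult:
  assumes "(y :: 'a) ^ (2 ^ d) = y" shows "y ^ (2 ^ (d * k)) = y"
  by (induction k) (simp_all add: power_add power_mult assms)

text \<open>A nonzero remainder of r modulo the period would be a smaller period.\<close>

lemma period_dvd: "period x dvd r"
proof (rule ccontr)
  assume "\<not> period x dvd r"
  then have pos: "r mod period x \<ge> 1" by (simp add: dvd_eq_mod_eq_0 Suc_le_eq)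
  have "x = x ^ (2 ^ (period x * (r div period x) + r mod period x))"
    using power_card[of x] by simp
  also have "\<dots> = (x ^ (2 ^ (period x * (r div period x)))) ^ (2 ^ (r mod period x))"
    by (simp only: power_add power_mult)
  also have "\<dots> = x ^ (2 ^ (r mod period x))"
    by (simp only: frobenius_period_mult[OF period(2)])
  finally have "period x \<le> r mod period x" using pos by (intro period_minimal) auto
  moreover have "r mod period x < period x" using period(1)[of x] by simp
  ultimately show False by simp
qed

lemma inj_on_frobenius_orbit: "inj_on (\<lambda>i. x ^ (2 ^ i)) {..<period x}"
proof (rule linorder_inj_onI)
  fix i j assume ij: "i < j" "j \<in> {..<period x}"
  show "x ^ (2 ^ i) \<noteq> x ^ (2 ^ j)"
  proof
    assume "x ^ (2 ^ i) = x ^ (2 ^ j)"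
    then have "(x ^ (2 ^ i)) ^ (2 ^ (period x - j)) = (x ^ (2 ^ j)) ^ (2 ^ (period x - j))"
      by simp
    then have "x ^ (2 ^ (i + (period x - j))) = x ^ (2 ^ (j + (period x - j)))"
      by (simp only: power_add power_mult)
    then have "x ^ (2 ^ (i + (period x - j))) = x" using ij period(2)[of x] by simp
    then have "period x \<le> i + (period x - j)" using ij by (intro period_minimal) auto
    with ij show False by auto
  qed
qed auto

definition orbit_poly :: "'a \<Rightarrow> 'a poly" where
  "orbit_poly x = (\<Prod>i<period x. [:- (x ^ (2 ^ i)), 1:])"

text \<open>Collapsing every nonzero coefficient to 1 inverts \<open>emb\<close> only because
  \<open>coeff_orbit_poly\<close> leaves no values besides 0 and 1.\<close>

definition minpoly :: "'a \<Rightarrow> gf2 poly" where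
  "minpoly x = map_poly (\<lambda>c. if c = 0 then 0 else 1) (orbit_poly x)"

lemma degree_orbit_poly [simp]: "degree (orbit_poly x) = period x"
  unfolding orbit_poly_def by (subst degree_prod_eq_sum_degree) auto

lemma lead_coeff_orbit_poly [simp]: "coeff (orbit_poly x) (period x) = 1"
proof -
  have "lead_coeff (orbit_poly x) = 1" unfolding orbit_poly_def lead_coeff_prod by simp
  then show ?thesis by simp
qed

text \<open>Squaring the coefficients permutes the linear factors cyclically, so each coefficient
  equals its own square.\<close>

lemma coeff_orbit_poly: "coeff (orbit_poly x) n = 0 \<or> coeff (orbit_poly x) n = 1"
proof -
  let ?F = "map_poly (\<lambda>c :: 'a. c ^ 2)"
  let ?lin = "\<lambda>i. [:- (x ^ (2 ^ i)), 1:]"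
  have mult: "?F (p * q) = ?F p * ?F q" for p q
    by (rule map_poly_mult) (auto simp: power_mult_distrib frobenius_add[of _ _ 1, simplified])
  have prod: "?F (\<Prod>i\<in>A. ?lin i) = (\<Prod>i\<in>A. ?F (?lin i))" for A :: "nat set"
    by (induction A rule: infinite_finite_induct) (simp_all add: mult del: mult_pCons_left mult_pCons_right)
  have "?F (orbit_poly x) = (\<Prod>i<period x. ?lin (Suc i))"
    unfolding orbit_poly_def prod
    by (intro prod.cong refl)
       (simp add: map_poly_pCons uminus_eq power_mult[symmetric] mult.commute)
  \<comment> \<open>The extra factor replaces a cyclic reindexing: the factors with index 0 and
    \<open>period x\<close> agree, so it cancels in the end.\<close>
  also have "\<dots> * ?lin 0 = (\<Prod>i<Suc (period x). ?lin i)"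
    by (subst prod.lessThan_Suc_shift) (simp only: mult.commute)
  also have "\<dots> = orbit_poly x * ?lin 0"
    by (simp add: orbit_poly_def period)
  finally have "?F (orbit_poly x) = orbit_poly x" by (simp del: mult_pCons_left mult_pCons_right)
  then have "coeff (orbit_poly x) n ^ 2 = coeff (orbit_poly x) n"
    by (metis (no_types, lifting) coeff_map_poly zero_power2)
  then have "coeff (orbit_poly x) n * (coeff (orbit_poly x) n - 1) = 0"
    by (simp add: power2_eq_square algebra_simps)
  then show ?thesis by simp
qed

lemma emb_minpoly: "emb_poly (minpoly x) = orbit_poly x"
  using coeff_orbit_poly[of x] by (intro poly_eqI) (auto simp: minpoly_def coeff_map_poly emb_def)

lemma degree_minpoly [simp]: "degree (minpoly x) = period x"
  using degree_emb_poly[of "minpoly x"] by (simp add: emb_minpoly)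

lemma minpoly_root: "poly (emb_poly (minpoly x)) x = 0"
  unfolding emb_minpoly orbit_poly_def poly_prod
  using period(1)[of x] by (intro prod_zero bexI[of _ 0]) auto

text \<open>A polynomial over the prime field that vanishes at \<open>x\<close> vanishes on the
  whole orbit, which has \<open>period x\<close> distinct elements.\<close>

lemma period_le_degree:
  assumes "poly (emb_poly p) x = 0" "p \<noteq> 0" shows "period x \<le> degree p"
proof -
  have "emb_poly p \<noteq> 0" using assms by (simp add: map_poly_eq_0_iff)
  have "period x = card ((\<lambda>i. x ^ (2 ^ i)) ` {..<period x})"
    using card_image[OF inj_on_frobenius_orbit[of x]] by simp
  also have "\<dots> \<le> card {y. poly (emb_poly p) y = 0}"
    by (intro card_mono) (auto intro: emb_poly_root_frobenius[OF assms(1)])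
  also have "\<dots> \<le> degree p"
    using card_poly_roots_bound[OF \<open>emb_poly p \<noteq> 0\<close>] by simp
  finally show ?thesis .
qed

text \<open>In a factorization, one factor has the root \<open>x\<close> and thus already the full
  degree, by \<open>period_le_degree\<close>; the other is constant.\<close>

lemma minpoly_irred: "minpoly x \<in> monic_irreds"
proof -
  have lc: "lead_coeff (minpoly x) = 1"
    unfolding degree_minpoly by (simp add: minpoly_def coeff_map_poly)
  have "irreducible (minpoly x)"
  proof (rule irreducibleI)
    show ne: "minpoly x \<noteq> 0" using lc by auto
    show "\<not> is_unit (minpoly x)" using period(1)[of x] ne by (simp add: is_unit_iff_degree)
    fix g h assume gh: "minpoly x = g * h"
    with ne have ne': "g \<noteq> 0" "h \<noteq> 0" by auto
    have "period x = degree g + degree h" using gh degree_mult_eq[OF ne'] degree_minpoly[of x] by simp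
    moreover have "poly (emb_poly g) x * poly (emb_poly h) x = 0"
      using minpoly_root[of x] by (simp add: gh emb_poly_mult)
    then have "period x \<le> degree g \<or> period x \<le> degree h"
      using ne' period_le_degree by auto
    ultimately show "is_unit g \<or> is_unit h" using ne' by (auto simp: is_unit_iff_degree)
  qed
  with lc show ?thesis by (simp add: monic_irreds_def)
qed

lemma coeff_0_minpoly: "x \<noteq> 0 \<Longrightarrow> coeff (minpoly x) 0 \<noteq> 0"
  using log_coeff_prod(2)[of "{..<period x}" "\<lambda>i. [:- (x ^ (2 ^ i)), 1:]"]
  by (simp add: minpoly_def coeff_map_poly orbit_poly_def)

text \<open>Since \<open>y\<close> is fixed by the d-th power of Frobenius, the d * k conjugates
  form k identical blocks.\<close>

lemma trace2_mult:
  assumes "(y :: 'a) ^ (2 ^ d) = y" shows "trace2 (d * k) y = of_nat k * trace2 d y"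
proof (induction k)
  case (Suc k)
  have split: "(\<Sum>i<a + b. f i) = (\<Sum>i<a. f i) + (\<Sum>i<b. f (a + i))" for a b :: nat and f :: "nat \<Rightarrow> 'a"
    by (induction b) (simp_all add: add_ac)
  have "trace2 (d * Suc k) y = trace2 (d * k) y + (\<Sum>i<d. y ^ (2 ^ (d * k + i)))"
    unfolding trace2_def mult_Suc_right add.commute[of d] by (rule split)
  moreover have "y ^ (2 ^ (d * k + i)) = y ^ (2 ^ i)" for i
  proof -
    have "y ^ (2 ^ (d * k + i)) = (y ^ (2 ^ (d * k))) ^ (2 ^ i)" by (simp only: power_add power_mult)
    then show ?thesis by (simp only: frobenius_period_mult[OF assms])
  qed
  then have "(\<Sum>i<d. y ^ (2 ^ (d * k + i))) = trace2 d y" by (simp add: trace2_def)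
  ultimately show ?case using Suc by (simp add: algebra_simps)
qed (simp add: trace2_def)

text \<open>The conjugates of \<open>x\<close> are the roots of its minimal polynomial, so the two
  traces are the sums of the roots and of their inverses.\<close>

lemma trace2_period:
  assumes "x \<noteq> 0"
  shows "trace2 (period x) (x + 1 / x) =
    emb (log_coeff (reflect_poly (minpoly x)) + log_coeff (minpoly x))"
proof -
  let ?lin = "\<lambda>i. [:- (x ^ (2 ^ i)), 1:]"
  have "trace2 (period x) (x + 1 / x) = (\<Sum>i<period x. x ^ (2 ^ i)) + (\<Sum>i<period x. 1 / x ^ (2 ^ i))"
    unfolding trace2_add by (simp add: trace2_def power_one_over)
  also have "(\<Sum>i<period x. x ^ (2 ^ i)) = log_coeff (reflect_poly (orbit_poly x))"
    unfolding orbit_poly_def reflect_poly_prod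
    by (subst log_coeff_prod) (simp_all add: log_coeff_def coeff_reflect_poly uminus_eq)
  also have "(\<Sum>i<period x. 1 / x ^ (2 ^ i)) = log_coeff (orbit_poly x)"
    unfolding orbit_poly_def using assms
    by (subst log_coeff_prod) (simp_all add: log_coeff_def uminus_eq)
  finally show ?thesis
    by (simp add: emb_reflect_poly emb_log_coeff flip: emb_minpoly)
qed

lemma of_nat_eq_0: "of_nat k = (0 :: 'a) \<longleftrightarrow> even k"
  by (simp add: of_nat_eq_0_iff_char_dvd char_2)

text \<open>The trace from the big field is the trace from the subfield generated by
  \<open>x\<close> added up \<open>r div period x\<close> times; multiplying by that number becomes
  a power of the sign.\<close>

lemma add_char_minpoly:
  assumes "x \<noteq> 0"
  shows "add_char r (x + 1 / x) = twist 1 1 1 (minpoly x) ^ (r div period x)"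
proof -
  obtain k where k: "r = period x * k" using period_dvd[of x] by (auto simp: dvd_def)
  then have k': "r div period x = k" using period(1)[of x] by auto
  let ?z = "log_coeff (reflect_poly (minpoly x)) + log_coeff (minpoly x)"
  have "(x + 1 / x) ^ (2 ^ period x) = x + 1 / x"
    by (simp add: frobenius_add power_one_over period)
  then have "trace2 r (x + 1 / x) = of_nat k * emb ?z"
    unfolding trace2_period[OF assms, symmetric] k by (rule trace2_mult)
  then have "trace2 r (x + 1 / x) = 0 \<longleftrightarrow> even k \<or> ?z = 0"
    by (simp add: of_nat_eq_0 del: emb_simps(3))
  then show ?thesis
    using assms by (auto simp: k' add_char_def[of r] twist_def coeff_0_minpoly add_char_gf2)
qed

text \<open>The sum over the nonzero elements is grouped by minimal polynomials over the prime field.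
  Every fibre has at most as many elements as the degree of its polynomial, and both sides add up to
  \<open>2 ^ r - 1\<close>, so equality holds in every fibre.\<close>

lemma kloosterman_eq_power_sum: "kloosterman = power_sum (twist 1 (1 :: gf2) 1) r"
proof -
  define I where "I = {P \<in> monic_irreds :: gf2 poly set. degree P dvd r \<and> coeff P 0 \<noteq> 0}"
  define fib where "fib P = {x :: 'a. x \<noteq> 0 \<and> minpoly x = P}" for P
  have fin: "finite I"
    by (rule finite_subset[OF _ finite_monic_irreds[of r]]) (use r_pos in \<open>auto simp: I_def dvd_imp_le\<close>)
  have finJ: "finite {P \<in> monic_irreds :: gf2 poly set. degree P dvd r}"
    by (rule finite_subset[OF _ finite_monic_irreds[of r]]) (use r_pos in \<open>auto simp: dvd_imp_le\<close>)
  \<comment> \<open>A positive exponent is what lets the polynomial T drop out: its twist is 0, but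
    0^0 would be 1.\<close>
  have pos: "r div degree P > 0" if "P \<in> monic_irreds" "degree P dvd r" for P :: "gf2 poly"
    using that r_pos monic_irreds_degree[of P] by (auto simp: div_greater_zero_iff dvd_imp_le)
  have power_sum_I: "power_sum (twist 1 (u :: gf2) v) r =
      (\<Sum>P\<in>I. int (degree P) * twist 1 u v P ^ (r div degree P))" for u v
    unfolding power_sum_def
  proof (rule sum.mono_neutral_right[OF finJ])
    show "\<forall>P\<in>{P \<in> monic_irreds. degree P dvd r} - I.
        int (degree P) * twist 1 u v P ^ (r div degree P) = 0"
    proof
      fix P assume "P \<in> {P \<in> monic_irreds. degree P dvd r} - I"
      then have "r div degree P > 0" "twist 1 u v P = 0" using pos[of P] by (auto simp: I_def twist_def)
      then show "int (degree P) * twist 1 u v P ^ (r div degree P) = 0" by simp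
    qed
  qed (auto simp: I_def)
  have maps: "minpoly ` (UNIV - {0}) \<subseteq> I"
    using minpoly_irred period_dvd coeff_0_minpoly by (auto simp: I_def)
  have group: "(\<Sum>P\<in>I. \<Sum>x\<in>fib P. F x) = (\<Sum>x\<in>UNIV - {0}. F x)" for F :: "'a \<Rightarrow> int"
    using sum.group[OF _ fin maps, of F] by (simp add: fib_def)
  have fib_le: "card (fib P) \<le> degree P" if "P \<in> I" for P
  proof -
    have "emb_poly P \<noteq> 0" using that by (auto simp: I_def map_poly_eq_0_iff)
    have "card (fib P) \<le> card {x. poly (emb_poly P) x = 0}"
      using minpoly_root by (intro card_mono) (auto simp: fib_def)
    also have "\<dots> \<le> degree P" using card_poly_roots_bound[OF \<open>emb_poly P \<noteq> 0\<close>] by simp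
    finally show ?thesis .
  qed
  have "(\<Sum>P\<in>I. int (card (fib P))) = int CARD('a) - 1"
    using group[of "\<lambda>_. 1"] finite_UNIV_card_ge_0[where ?'a = 'a]
    by (simp add: card_Diff_singleton of_nat_diff)
  \<comment> \<open>The trivial twist over the prime field provides the total degree of the
    polynomials in \<open>I\<close> without counting them.\<close>
  also have "\<dots> = power_sum (twist 1 (0 :: gf2) 0) r"
    using binary_field.power_sum_twist_0_0[OF binary_field_gf2 r_pos]
    by (simp add: UNIV_gf2 card_field)
  also have "\<dots> = (\<Sum>P\<in>I. int (degree P))"
    unfolding power_sum_I by (intro sum.cong refl) (simp add: twist_def I_def add_char_gf2)
  finally have "(\<Sum>P\<in>I. int (card (fib P))) = (\<Sum>P\<in>I. int (degree P))" .
  then have fib_eq: "int (card (fib P)) = int (degree P)" if "P \<in> I" for P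
    using sum_mono_inv[of "\<lambda>P. int (card (fib P))" I "\<lambda>P. int (degree P)" P] fib_le fin that by simp
  have "kloosterman = (\<Sum>P\<in>I. \<Sum>x\<in>fib P. add_char r (x + 1 / x))"
    by (simp add: group kloosterman_def)
  also have "\<dots> = (\<Sum>P\<in>I. \<Sum>x\<in>fib P. twist 1 1 1 P ^ (r div degree P))"
    by (intro sum.cong refl) (auto simp: fib_def add_char_minpoly)
  also have "\<dots> = power_sum (twist 1 (1 :: gf2) 1) r"
    unfolding power_sum_I by (intro sum.cong refl) (simp add: fib_eq)
  finally show ?thesis .
qed

lemma of_int_kloosterman: "of_int kloosterman = - (alpha ^ r + cnj alpha ^ r)"
  unfolding kloosterman_eq_power_sum by (rule power_sum_gf2) (rule r_pos)

text \<open>\<open>of_int_kloosterman\<close> and |alpha|^2 = 2 identify the reciprocal roots over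
  the big field as the r-th powers of alpha and its conjugate.\<close>

lemma power_sum_kloosterman:
  assumes "n \<ge> 1"
  shows "of_int (power_sum (twist r (1 :: 'a) 1) n) = - (alpha ^ (r * n) + cnj alpha ^ (r * n))"
  unfolding power_mult
proof (rule power_sum_twist_both[OF assms])
  show "alpha ^ r + cnj alpha ^ r = - of_int kloosterman" by (simp add: of_int_kloosterman)
  show "alpha ^ r * cnj alpha ^ r = of_nat CARD('a)"
    by (simp add: alpha_mult_cnj card_field flip: power_mult_distrib)
qed

end

section \<open>Counting A-polynomials\<close>

lemma moebius_prime_mult:
  assumes "prime p" "\<not> p dvd d" "squarefree d"
  shows "moebius (p * d) = - moebius d"
proof -
  have d0: "d \<noteq> 0" using assms(2) by (metis dvd_0_right)
  have "coprime p d" using assms by (simp add: prime_imp_coprime)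
  then have "squarefree (p * d)" using assms by (simp add: squarefree_mult_coprime squarefree_prime)
  moreover have "prime_factors (p * d) = insert p (prime_factors d)"
    using assms d0 by (subst prime_factors_product) (auto simp: prime_prime_factors)
  moreover have "p \<notin> prime_factors d" using assms by auto
  ultimately show ?thesis using assms by (simp add: moebius_def)
qed

text \<open>For a fixed prime p dividing n, the squarefree divisors d and p d with p not dividing d
  cancel in pairs.\<close>

lemma sum_moebius:
  assumes "n > 0"
  shows "(\<Sum>d | d dvd n. moebius d) = (if n = 1 then 1 else 0)"
proof (cases "n = 1")
  case True
  then show ?thesis by (simp add: moebius_def)
next
  case False
  then obtain p where p: "prime p" "p dvd n" using prime_factor_nat by blast
  define D where "D = {d. d dvd n \<and> squarefree d}"
  have fin: "finite D" using assms by (auto simp: D_def)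
  have "(\<Sum>d | d dvd n. moebius d) = sum moebius D"
    using assms by (intro sum.mono_neutral_right) (auto simp: D_def moebius_def)
  also have "\<dots> = sum moebius {d \<in> D. p dvd d} + sum moebius {d \<in> D. \<not> p dvd d}"
    by (subst sum.union_disjoint[symmetric]) (use fin in \<open>auto intro: sum.cong\<close>)
  also have "sum moebius {d \<in> D. p dvd d} = (\<Sum>d \<in> {d \<in> D. \<not> p dvd d}. moebius (p * d))"
  proof (rule sum.reindex_bij_witness[of _ "\<lambda>d. p * d" "\<lambda>d. d div p"])
    fix d assume d: "d \<in> {d \<in> D. p dvd d}"
    then obtain e where e: "d = p * e" by auto
    have "\<not> p dvd e"
    proof
      assume "p dvd e"
      then have "p ^ 2 dvd d" using e by (auto simp: power2_eq_square)
      then show False using d p by (auto simp: D_def squarefree_def)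
    qed
    moreover have "squarefree e" using d e squarefree_multD(2)[of p e] by (auto simp: D_def)
    ultimately show "d div p \<in> {d \<in> D. \<not> p dvd d}" "p * (d div p) = d"
        "moebius (p * (d div p)) = moebius d"
      using d e p prime_gt_0_nat[of p] by (auto simp: D_def dest: dvd_mult_right)
  next
    fix d assume d: "d \<in> {d \<in> D. \<not> p dvd d}"
    then have "coprime p d" using p by (auto simp: prime_imp_coprime)
    then have "p * d dvd n" "squarefree (p * d)"
      using d p by (auto simp: D_def divides_mult squarefree_mult_coprime squarefree_prime)
    then show "p * d \<in> {d \<in> D. p dvd d}" by (auto simp: D_def)
    show "p * d div p = d" using p prime_gt_0_nat[of p] by simp
  qed
  also have "\<dots> = - sum moebius {d \<in> D. \<not> p dvd d}"
    unfolding sum_negf[symmetric] using p by (intro sum.cong) (auto simp: moebius_prime_mult D_def)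
  finally show ?thesis using False by simp
qed

text \<open>The relation is asked only at divisors of \<open>m\<close>; in the application it is
  available for odd arguments.\<close>

lemma moebius_inversion:
  fixes g F :: "nat \<Rightarrow> int"
  assumes "m > 0" and F: "\<And>d. d dvd m \<Longrightarrow> F d = (\<Sum>e | e dvd d. g e)"
  shows "(\<Sum>d | d dvd m. moebius (m div d) * F d) = g m"
proof -
  have "(\<Sum>d | d dvd m. moebius (m div d) * F d) =
      (\<Sum>d | d dvd m. \<Sum>e | e dvd m \<and> e dvd d. moebius (m div d) * g e)"
  proof (rule sum.cong[OF refl])
    fix d assume "d \<in> {d. d dvd m}"
    then have "{e. e dvd d} = {e. e dvd m \<and> e dvd d}" using dvd_trans by blast
    with \<open>d \<in> _\<close> show "moebius (m div d) * F d =
        (\<Sum>e | e dvd m \<and> e dvd d. moebius (m div d) * g e)"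
      by (simp add: F sum_distrib_left)
  qed
  also have "\<dots> = (\<Sum>e | e dvd m. \<Sum>d | d dvd m \<and> e dvd d. moebius (m div d) * g e)"
    using sum.swap_restrict[of "{d. d dvd m}" "{e. e dvd m}" "\<lambda>d e. moebius (m div d) * g e" "\<lambda>d e. e dvd d"]
      assms(1) by simp
  also have "\<dots> = (\<Sum>e | e dvd m. if e = m then g e else 0)"
  proof (rule sum.cong[OF refl])
    fix e assume e: "e \<in> {e. e dvd m}"
    then have e0: "e > 0" using assms(1) by (auto intro: gr0I)
    have "(\<Sum>d | d dvd m \<and> e dvd d. moebius (m div d)) = (\<Sum>c | c dvd m div e. moebius c)"
      by (rule sum.reindex_bij_witness[of _ "\<lambda>c. m div c" "\<lambda>d. m div d"])
         (use assms(1) e e0 in \<open>auto elim!: dvdE simp: dvd_def\<close>)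
    also have "\<dots> = (if e = m then 1 else 0)"
      using e e0 assms(1) by (subst sum_moebius) (auto simp: div_greater_zero_iff dvd_imp_le elim!: dvdE)
    finally show "(\<Sum>d | d dvd m \<and> e dvd d. moebius (m div d) * g e) = (if e = m then g e else 0)"
      by (simp flip: sum_distrib_right)
  qed
  also have "\<dots> = g m" using assms(1) by (simp add: sum.delta)
  finally show ?thesis .
qed

lemma abs_moebius_le: "\<bar>moebius n\<bar> \<le> 1"
  by (simp add: moebius_def power_abs)

text \<open>An odd quotient leaves the whole factor 2^k inside the divisor.\<close>

lemma odd_quotient_divisors:
  assumes "n = 2 ^ k * m" "odd (m :: nat)"
  shows "{d. d dvd n \<and> odd (n div d)} = (\<lambda>d. 2 ^ k * d) ` {d. d dvd m}"
proof (intro equalityI subsetI)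
  fix d assume "d \<in> {d. d dvd n \<and> odd (n div d)}"
  then have d: "d dvd n" "odd (n div d)" by auto
  have "n = d * (n div d)" using d by simp
  then have "2 ^ k dvd d * (n div d)" using assms by (metis dvd_triv_left)
  moreover have "coprime (2 ^ k) (n div d)" using d(2) by simp
  ultimately have "2 ^ k dvd d" by (simp add: coprime_dvd_mult_left_iff)
  then obtain e where e: "d = 2 ^ k * e" by (auto simp: dvd_def)
  then have "e dvd m" using d assms by simp
  then show "d \<in> (\<lambda>d. 2 ^ k * d) ` {d. d dvd m}" using e by blast
next
  fix d assume "d \<in> (\<lambda>d. 2 ^ k * d) ` {d. d dvd m}"
  then obtain e where e: "d = 2 ^ k * e" "e dvd m" by auto
  then have "n div d = m div e" using assms by simp
  moreover have "odd (m div e)" using e assms(2) by (metis dvd_div_mult_self dvd_mult2)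
  ultimately show "d \<in> {d. d dvd n \<and> odd (n div d)}" using e assms by simp
qed

text \<open>The smallest odd quotient other than 1 is 3, the origin of all exponents n/3.\<close>

lemma proper_odd_quotient_le:
  assumes "d dvd n" "odd (n div d)" "d \<noteq> n" "n > 0" shows "3 * d \<le> (n :: nat)"
proof -
  obtain c where c: "n = d * c" using assms(1) by (auto simp: dvd_def)
  then have "odd c" "c \<noteq> 1" using assms by auto
  then have "c \<ge> 3" by (cases c; simp; presburger)
  then show ?thesis using c by simp
qed

section \<open>The exact count\<close>

context binary_field
begin

text \<open>The number of points of the elliptic curve \<open>y\<^sup>2 + y = x + 1/x\<close> over the extension of degree \<open>n\<close>.\<close>

definition point_count :: "nat \<Rightarrow> int" where
  "point_count n = int CARD('a) ^ n + 1 + power_sum (twist r (1 :: 'a) 1) n"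

lemma A_polynomial_iff:
  assumes "P \<in> monic_irreds"
  shows "A_polynomial r (P :: 'a poly) \<longleftrightarrow> coeff P 0 \<noteq> 0 \<and>
    add_char r (log_coeff (reflect_poly P)) = - 1 \<and> add_char r (log_coeff P) = - 1"
proof -
  have "log_coeff (reflect_poly P) = coeff P (degree P - 1)"
    using assms monic_irreds_degree[of P] by (intro log_coeff_reflect_monics monic_irreds_monics) auto
  moreover have "trace2 r (0 :: 'a) = 0" using r_pos by (simp add: trace2_def power_0_left)
  ultimately show ?thesis
    using assms
    by (auto simp: A_polynomial_def monic_irreds_def trace2_eq_1_iff log_coeff_def)
qed

text \<open>With signs s and t the left side is (1 - s^k)(1 - t^k), which is 4 if s = t = -1 and k
  is odd, and 0 otherwise. For P = T all four powers vanish, as k is positive.\<close>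

lemma twist_combination:
  assumes "P \<in> monic_irreds" "k > 0"
  shows "twist r (0 :: 'a) 0 P ^ k - twist r 1 0 P ^ k - twist r 0 1 P ^ k + twist r 1 1 P ^ k =
    (if A_polynomial r P \<and> odd k then 4 else 0)"
proof (cases "coeff P 0 = 0")
  case True
  then show ?thesis using assms by (simp add: twist_def A_polynomial_iff)
next
  case False
  then show ?thesis
    using assms(1) add_char_cases[of "log_coeff (reflect_poly P)"] add_char_cases[of "log_coeff P"]
    by (auto simp: twist_def A_polynomial_iff add_char_add)
qed

text \<open>The combination of the four power sums is (q^n - 1) + 1 + 1 plus the Kloosterman term,
  which is \<open>point_count n\<close>; \<open>twist_combination\<close> evaluates it irreducible
  by irreducible.\<close>

lemma sum_A_count:
  assumes "n \<ge> 1"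
  shows "(\<Sum>d | d dvd n \<and> odd (n div d). 4 * int (d * A_count TYPE('a) r d)) = point_count n"
proof -
  define J where "J = {P \<in> monic_irreds :: 'a poly set. degree P dvd n}"
  have fin: "finite J"
    by (rule finite_subset[OF _ finite_monic_irreds[of n]]) (use assms in \<open>auto simp: J_def dvd_imp_le\<close>)
  have pos: "n div degree P > 0" if "P \<in> J" for P
    using that assms monic_irreds_degree[of P] by (auto simp: J_def div_greater_zero_iff dvd_imp_le)
  let ?D = "{d. d dvd n \<and> odd (n div d)}" and ?B = "{P \<in> J. A_polynomial r P \<and> odd (n div degree P)}"
  have "point_count n = power_sum (twist r (0 :: 'a) 0) n - power_sum (twist r (1 :: 'a) 0) n
      - power_sum (twist r (0 :: 'a) 1) n + power_sum (twist r (1 :: 'a) 1) n"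
    using assms by (simp add: point_count_def power_sum_twist_0_0 power_sum_twist_left power_sum_twist_right)
  also have "\<dots> = (\<Sum>P\<in>J. int (degree P) * (twist r 0 0 P ^ (n div degree P) - twist r 1 0 P ^ (n div degree P)
      - twist r 0 1 P ^ (n div degree P) + twist r 1 1 P ^ (n div degree P)))"
    unfolding power_sum_def J_def[symmetric] by (simp add: sum.distrib sum_subtractf algebra_simps)
  also have "\<dots> = (\<Sum>P\<in>J. if A_polynomial r P \<and> odd (n div degree P) then 4 * int (degree P) else 0)"
  proof (rule sum.cong[OF refl])
    fix P assume "P \<in> J"
    then show "int (degree P) * (twist r 0 0 P ^ (n div degree P) - twist r 1 0 P ^ (n div degree P)
      - twist r 0 1 P ^ (n div degree P) + twist r 1 1 P ^ (n div degree P)) =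
      (if A_polynomial r P \<and> odd (n div degree P) then 4 * int (degree P) else 0)"
      by (subst twist_combination) (use pos in \<open>auto simp: J_def\<close>)
  qed
  also have "\<dots> = (\<Sum>P\<in>?B. 4 * int (degree P))"
    by (rule sum.inter_filter[OF fin, symmetric])
  also have "\<dots> = (\<Sum>d\<in>?D. \<Sum>P | P \<in> ?B \<and> degree P = d. 4 * int (degree P))"
  proof (rule sum.group[symmetric])
    show "finite ?B" using fin by simp
    show "finite ?D" using assms by simp
  qed (auto simp: J_def)
  also have "\<dots> = (\<Sum>d\<in>?D. 4 * int (d * A_count TYPE('a) r d))"
  proof (rule sum.cong[OF refl])
    fix d assume "d \<in> ?D"
    then have "{P. P \<in> ?B \<and> degree P = d} = {P. A_polynomial r P \<and> degree P = d}"
      by (auto simp: J_def monic_irreds_def A_polynomial_def)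
    then show "(\<Sum>P | P \<in> ?B \<and> degree P = d. 4 * int (degree P)) = 4 * int (d * A_count TYPE('a) r d)"
      by (simp add: A_count_def)
  qed
  finally show ?thesis by simp
qed

text \<open>With k held fixed, the relevant divisors of 2^k d are the 2^k e with e dividing d, so
  ordinary inversion on the odd part applies.\<close>

lemma A_count_eq_moebius_sum:
  assumes "n = 2 ^ k * m" "odd m"
  shows "4 * int (n * A_count TYPE('a) r n) = (\<Sum>d | d dvd m. moebius (m div d) * point_count (2 ^ k * d))"
proof -
  have m0: "m > 0" using assms(2) by (auto intro: gr0I)
  have "point_count (2 ^ k * d) = (\<Sum>e | e dvd d. 4 * int ((2 ^ k * e) * A_count TYPE('a) r (2 ^ k * e)))"
    if "d dvd m" for d
  proof -
    have d: "odd d" using that assms(2) dvd_trans by blast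
    then have "d > 0" by (auto intro: gr0I)
    then have "point_count (2 ^ k * d) =
        (\<Sum>e \<in> (\<lambda>e. 2 ^ k * e) ` {e. e dvd d}. 4 * int (e * A_count TYPE('a) r e))"
      using sum_A_count[of "2 ^ k * d"] odd_quotient_divisors[OF refl d, of k] by simp
    also have "\<dots> = (\<Sum>e | e dvd d. 4 * int ((2 ^ k * e) * A_count TYPE('a) r (2 ^ k * e)))"
      by (subst sum.reindex) (auto simp: inj_on_def)
    finally show ?thesis .
  qed
  from moebius_inversion[OF m0 this] show ?thesis using assms(1) by simp
qed

lemma of_int_point_count:
  assumes "n \<ge> 1"
  shows "of_int (point_count n) = of_nat CARD('a) ^ n + 1 - alpha ^ (r * n) - cnj alpha ^ (r * n)"
  using power_sum_kloosterman[OF assms] by (simp add: point_count_def)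

text \<open>The Hasse bound, from |alpha| = sqrt 2.\<close>

lemma point_count_bound:
  assumes "n \<ge> 1"
  shows "\<bar>real_of_int (point_count n) - real CARD('a) ^ n - 1\<bar> \<le> 2 * sqrt (real CARD('a) ^ n)"
proof -
  have "real_of_int (point_count n) - real CARD('a) ^ n - 1 = real_of_int (power_sum (twist r (1 :: 'a) 1) n)"
    by (simp add: point_count_def)
  then have "\<bar>real_of_int (point_count n) - real CARD('a) ^ n - 1\<bar> =
      cmod (of_int (power_sum (twist r (1 :: 'a) 1) n))" by simp
  also have "\<dots> \<le> cmod (alpha ^ (r * n)) + cmod (cnj alpha ^ (r * n))"
    unfolding power_sum_kloosterman[OF assms] norm_minus_cancel by (rule norm_triangle_ineq)
  also have "\<dots> = 2 * sqrt 2 ^ (r * n)" by (simp add: norm_power norm_alpha)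
  also have "sqrt 2 ^ (r * n) = sqrt (real CARD('a) ^ n)"
    by (simp add: card_field power_mult real_sqrt_power)
  finally show ?thesis .
qed

section \<open>Error term and asymptotics\<close>

lemma sqrt_q_power: "sqrt (real CARD('a) ^ n) = 2 powr (real (r * n) / 2)"
proof -
  have "real CARD('a) ^ n = 2 powr real (r * n)"
    by (subst powr_realpow) (simp_all add: card_field power_mult)
  then show ?thesis by (simp add: powr_half_sqrt[symmetric] powr_powr)
qed

lemma q_ge_2: "CARD('a) \<ge> 2"
  using power_increasing[OF r_pos, of "2 :: nat"] by (simp add: card_field)

text \<open>The last summand, of order q^(n/2), is the Hasse error of the term d = m. The divisors d
  < m satisfy d \<le> m/3 and contribute at most \<open>B\<close> each.\<close>

lemma A_count_estimate:
  assumes "n = 2 ^ k * m" "odd m"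
  shows "\<bar>4 * real n * real (A_count TYPE('a) r n) - real CARD('a) ^ n\<bar> \<le>
    real (sigma0 m) * (real CARD('a) powr (real n / 3) + 1 + 2 * 2 powr (real (r * n) / 6)) +
    2 * 2 powr (real (r * n) / 2)"
proof -
  have m0: "m > 0" using assms(2) by (auto intro: gr0I)
  then have n1: "n \<ge> 1" using assms(1) by simp
  let ?t = "\<lambda>d. real_of_int (moebius (m div d)) * real_of_int (point_count (2 ^ k * d))"
  define B where "B = real CARD('a) powr (real n / 3) + 1 + 2 * 2 powr (real (r * n) / 6)"
  have B1: "B \<ge> 1" by (simp add: B_def)
  have "4 * real n * real (A_count TYPE('a) r n) = real_of_int (4 * int (n * A_count TYPE('a) r n))" by simp
  also have "\<dots> = (\<Sum>d | d dvd m. ?t d)" unfolding A_count_eq_moebius_sum[OF assms] by simp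
  also have "\<dots> = ?t m + (\<Sum>d \<in> {d. d dvd m} - {m}. ?t d)"
    using m0 by (intro sum.remove) auto
  also have "?t m = real_of_int (point_count n)" using m0 assms(1) by (simp add: moebius_def)
  finally have eq: "4 * real n * real (A_count TYPE('a) r n) - real CARD('a) ^ n =
      (real_of_int (point_count n) - real CARD('a) ^ n - 1) + 1 + (\<Sum>d \<in> {d. d dvd m} - {m}. ?t d)" by simp
  have "\<bar>?t d\<bar> \<le> B" if "d \<in> {d. d dvd m} - {m}" for d
  proof -
    have d: "d dvd m" "d \<noteq> m" using that by auto
    then have "odd (m div d)" using assms(2) by (metis dvd_div_mult_self dvd_mult2)
    then have "3 * d \<le> m" using d m0 by (intro proper_odd_quotient_le)
    then have "3 * (2 ^ k * d) \<le> n" unfolding assms(1) by simp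
    moreover define N where "N = 2 ^ k * d"
    ultimately have N: "real N \<le> real n / 3" by linarith
    have "N \<ge> 1" using d m0 by (auto simp: N_def Suc_le_eq intro: gr0I)
    have "\<bar>?t d\<bar> = \<bar>real_of_int (moebius (m div d))\<bar> * \<bar>real_of_int (point_count N)\<bar>"
      by (simp add: abs_mult N_def)
    also have "\<dots> \<le> 1 * \<bar>real_of_int (point_count N)\<bar>"
      using abs_moebius_le[of "m div d"] by (intro mult_right_mono) linarith+
    also have "\<dots> \<le> real CARD('a) ^ N + 1 + 2 * sqrt (real CARD('a) ^ N)"
    proof -
      have "real CARD('a) ^ N \<ge> 0" by simp
      then show ?thesis using point_count_bound[OF \<open>N \<ge> 1\<close>] by linarith
    qed
    also have "\<dots> \<le> B"
    proof -
      have "real CARD('a) ^ N = real CARD('a) powr real N"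
        using q_ge_2 by (simp add: powr_realpow)
      also have "\<dots> \<le> real CARD('a) powr (real n / 3)" using N q_ge_2 by (intro powr_mono) auto
      finally have "real CARD('a) ^ N \<le> real CARD('a) powr (real n / 3)" .
      moreover have "real r * real N \<le> real r * (real n / 3)" using N by (intro mult_left_mono) auto
      then have "real (r * N) / 2 \<le> real (r * n) / 6" by (simp add: mult_ac)
      then have "sqrt (real CARD('a) ^ N) \<le> 2 powr (real (r * n) / 6)"
        unfolding sqrt_q_power by (intro powr_mono) auto
      ultimately show ?thesis unfolding B_def by linarith
    qed
    finally show ?thesis .
  qed
  then have "\<bar>\<Sum>d \<in> {d. d dvd m} - {m}. ?t d\<bar> \<le> real (card ({d. d dvd m} - {m})) * B"
    by (intro order_trans[OF sum_abs] sum_bounded_above)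
  also have "card ({d. d dvd m} - {m}) = sigma0 m - 1"
    using m0 by (simp add: sigma0_def card_Diff_singleton)
  also have "sigma0 m \<ge> 1" using m0 by (auto simp: sigma0_def Suc_le_eq card_gt_0_iff)
  then have "real (sigma0 m - 1) * B = real (sigma0 m) * B - B" by (simp add: of_nat_diff algebra_simps)
  finally have "\<bar>\<Sum>d \<in> {d. d dvd m} - {m}. ?t d\<bar> \<le> real (sigma0 m) * B - B" .
  \<comment> \<open>There are only \<open>sigma0 m - 1\<close> proper divisors; the spare
    \<open>B\<close>, at least 1, absorbs the 1 in q^n + 1.\<close>
  then show ?thesis
    unfolding B_def[symmetric] eq sqrt_q_power[symmetric]
    using point_count_bound[OF n1] B1 by linarith
qed

lemma A_count_asymp: "(\<lambda>n. real (A_count TYPE('a) r n)) \<sim>[at_top] (\<lambda>n. real CARD('a) ^ n / (4 * real n))"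
proof (rule asymp_equivI')
  \<comment> \<open>The constant is 4 + 2: the bracket is at most 4 sqrt Q and
    \<open>sigma0 m\<close> at most n, and the Hasse error adds 2 sqrt Q.\<close>
  have bound: "\<bar>real (A_count TYPE('a) r n) / (real CARD('a) ^ n / (4 * real n)) - 1\<bar> \<le> 6 * (real n * (1 / sqrt 2) ^ n)"
    if n: "n \<ge> 1" for n
  proof -
    obtain m where m: "n = 2 ^ multiplicity 2 n * m" "odd m"
      using multiplicity_decompose'[of n 2] n by auto
    define Q where "Q = real CARD('a) ^ n"
    have Q: "Q \<ge> 1" using q_ge_2 by (simp add: Q_def)
    have m0: "m > 0" using m(2) by (auto intro: gr0I)
    have "sigma0 m \<le> card {1..m}"
      unfolding sigma0_def using m0 by (intro card_mono) (auto simp: dvd_imp_le Suc_le_eq intro: gr0I)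
    also have "\<dots> \<le> n" 
    proof -
      have "m dvd n" using m(1) by (metis dvd_triv_right)
      then show ?thesis using n by (simp add: dvd_imp_le)
    qed
    finally have sigma: "real (sigma0 m) \<le> real n" by simp
    have root: "sqrt Q = real CARD('a) powr (real n / 2)" "sqrt Q = 2 powr (real (r * n) / 2)"
      unfolding Q_def using q_ge_2 sqrt_q_power
      by (auto simp: powr_half_sqrt[symmetric] powr_realpow[symmetric] powr_powr)
    have sQ: "sqrt Q \<ge> 1" using Q by simp
    have "real CARD('a) powr (real n / 3) \<le> sqrt Q"
      unfolding root(1) using q_ge_2 by (intro powr_mono) auto
    moreover have "2 powr (real (r * n) / 6) \<le> sqrt Q"
      unfolding root(2) by (intro powr_mono) auto
    ultimately have "real CARD('a) powr (real n / 3) + 1 + 2 * 2 powr (real (r * n) / 6) \<le> 4 * sqrt Q"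
      using sQ by linarith
    then have "real (sigma0 m) * (real CARD('a) powr (real n / 3) + 1 + 2 * 2 powr (real (r * n) / 6))
        \<le> real n * (4 * sqrt Q)"
      by (intro mult_mono sigma) auto
    moreover have "sqrt Q \<le> real n * sqrt Q" using n sQ by simp
    ultimately have est: "\<bar>4 * real n * real (A_count TYPE('a) r n) - Q\<bar> \<le> 6 * (real n * sqrt Q)"
      using A_count_estimate[OF m] unfolding Q_def[symmetric] root(2)[symmetric] by linarith
    have "real (A_count TYPE('a) r n) / (Q / (4 * real n)) - 1 = (4 * real n * real (A_count TYPE('a) r n) - Q) / Q"
      using Q n by (simp add: field_simps)
    then have "\<bar>real (A_count TYPE('a) r n) / (Q / (4 * real n)) - 1\<bar> =
        \<bar>4 * real n * real (A_count TYPE('a) r n) - Q\<bar> / Q"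
      using Q by simp
    also have "\<dots> \<le> 6 * (real n * sqrt Q) / Q" using est Q by (intro divide_right_mono) auto
    also have "\<dots> = 6 * (real n * (1 / sqrt Q))"
      using Q by (simp add: field_simps)
    also have "1 / sqrt Q \<le> 1 / sqrt 2 ^ n"
      unfolding Q_def real_sqrt_power using q_ge_2 by (intro divide_left_mono power_mono) auto
    finally show ?thesis by (simp add: Q_def power_one_over mult_left_mono)
  qed
  have "(\<lambda>n. real n * (1 / sqrt 2) ^ n) \<longlonglongrightarrow> 0"
    by (rule powser_times_n_limit_0) simp
  then have "(\<lambda>n. real (A_count TYPE('a) r n) / (real CARD('a) ^ n / (4 * real n)) - 1) \<longlonglongrightarrow> 0"
  proof (rule tendsto_0_le[where K = 6])
    show "\<forall>\<^sub>F n in sequentially. norm (real (A_count TYPE('a) r n) / (real CARD('a) ^ n / (4 * real n)) - 1)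
        \<le> norm (real n * (1 / sqrt 2) ^ n) * 6"
      using eventually_ge_at_top[of 1] by eventually_elim (use bound in \<open>simp add: mult.commute\<close>)
  qed
  then show "(\<lambda>n. real (A_count TYPE('a) r n) / (real CARD('a) ^ n / (4 * real n))) \<longlonglongrightarrow> 1"
    by (simp add: LIM_zero_iff)
qed

section \<open>Existence of A-polynomials\<close>

lemma point_count_pos:
  assumes "n \<ge> 1" shows "point_count n > 0"
proof -
  have "sqrt (real CARD('a) ^ n) > 1"
    using q_ge_2 assms by (simp add: one_less_power)
  then have "0 < (sqrt (real CARD('a) ^ n) - 1) ^ 2" by simp
  also have "\<dots> = real CARD('a) ^ n + 1 - 2 * sqrt (real CARD('a) ^ n)" by (simp add: power2_diff)
  also have "\<dots> \<le> real_of_int (point_count n)" using point_count_bound[OF assms] by linarith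
  finally show ?thesis by simp
qed

text \<open>With s = sqrt(q^n), 2s \<le> s^2 + 1 removes the root from the Hasse bound. The lower
  bound that follows uses 4s \<le> s^2 + 4 likewise, leaving integer inequalities linear in
  q^n.\<close>

lemma point_count_le: "n \<ge> 1 \<Longrightarrow> point_count n \<le> 2 * int CARD('a) ^ n + 2"
proof -
  assume n: "n \<ge> 1"
  have "0 \<le> (sqrt (real CARD('a) ^ n) - 1) ^ 2" by simp
  also have "\<dots> = real CARD('a) ^ n + 1 - 2 * sqrt (real CARD('a) ^ n)" by (simp add: power2_diff)
  finally have "real_of_int (point_count n) \<le> 2 * real CARD('a) ^ n + 2"
    using point_count_bound[OF n] by linarith
  also have "\<dots> = real_of_int (2 * int CARD('a) ^ n + 2)" by simp
  finally show ?thesis by (simp only: of_int_le_iff)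
qed

lemma point_count_ge: "n \<ge> 1 \<Longrightarrow> int CARD('a) ^ n \<le> 2 * point_count n + 2"
proof -
  assume n: "n \<ge> 1"
  have "0 \<le> (sqrt (real CARD('a) ^ n) - 2) ^ 2" by simp
  also have "\<dots> = real CARD('a) ^ n + 4 - 4 * sqrt (real CARD('a) ^ n)" by (simp add: power2_diff)
  finally have "real CARD('a) ^ n \<le> 2 * real_of_int (point_count n) + 2"
    using point_count_bound[OF n] by linarith
  also have "\<dots> = real_of_int (2 * point_count n + 2)" by simp
  finally have "real_of_int (int CARD('a) ^ n) \<le> real_of_int (2 * point_count n + 2)" by simp
  then show ?thesis by (simp only: of_int_le_iff)
qed

lemma A_count_term_le: "d \<ge> 1 \<Longrightarrow> 4 * int (d * A_count TYPE('a) r d) \<le> point_count d"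
  unfolding sum_A_count[symmetric] by (rule member_le_sum) auto

text \<open>The right side is exact for K = 0 and, as q \<ge> 2, grows by at least 2 q^(K+1) + 2 at
  each step.\<close>

lemma sum_point_count_le: "(\<Sum>d=1..K. point_count d) \<le> 6 * int CARD('a) ^ K - 6"
proof (induction K)
  case (Suc K)
  have "2 * int CARD('a) ^ K \<le> int CARD('a) ^ Suc K" "int CARD('a) ^ K \<ge> 1"
    using q_ge_2 by (auto intro: mult_right_mono)
  moreover have "(\<Sum>d=1..Suc K. point_count d) = (\<Sum>d=1..K. point_count d) + point_count (Suc K)"
    by simp
  ultimately show ?case using Suc point_count_le[of "Suc K"] by linarith
qed simp

text \<open>If the count were 0, proper divisors alone would have to supply
  \<open>point_count n\<close>. They are at most n/3, which forces q^n < 12 q^(n div 3); this fails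
  once q^(n - n div 3) \<ge> 16.\<close>

lemma A_count_pos:
  assumes "n \<ge> 1" "(r, n) \<noteq> (1, 3)"
  shows "A_count TYPE('a) r n \<ge> 1"
proof (rule ccontr)
  assume "\<not> A_count TYPE('a) r n \<ge> 1"
  then have A0: "A_count TYPE('a) r n = 0" by simp
  let ?D = "{d. d dvd n \<and> odd (n div d)}" and ?K = "n div 3"
  have "point_count n = (\<Sum>d \<in> ?D - {n}. 4 * int (d * A_count TYPE('a) r d))"
    unfolding sum_A_count[OF assms(1), symmetric]
    by (rule sum.mono_neutral_right) (use assms A0 in auto)
  have sub: "?D - {n} \<subseteq> {1..?K}"
  proof
    fix d assume "d \<in> ?D - {n}"
    then have "3 * d \<le> n" "d > 0"
      using assms proper_odd_quotient_le[of d n] by (auto intro: gr0I)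
    then show "d \<in> {1..?K}" by auto
  qed
  show False
  proof (cases "n \<in> {1, 2, 4}")
    \<comment> \<open>For powers of two no proper divisor has an odd quotient, so positivity of the
      point count is enough.\<close>
    case True
    have "d = n" if "d \<in> ?D" for d
    proof (rule ccontr)
      assume "d \<noteq> n"
      then have "d \<in> {1..?K}" using that sub by auto
      then show False using True that by auto
    qed
    then have "?D - {n} = {}" by auto
    then have "point_count n = 0" using \<open>point_count n = _\<close> by (simp only: sum.empty)
    then show False using point_count_pos[OF assms(1)] by simp
  next
    case False
    note \<open>point_count n = _\<close>
    also have "(\<Sum>d \<in> ?D - {n}. 4 * int (d * A_count TYPE('a) r d)) \<le> (\<Sum>d \<in> ?D - {n}. point_count d)"
      using sub by (intro sum_mono A_count_term_le) auto
    also have "\<dots> \<le> (\<Sum>d=1..?K. point_count d)"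
    proof (rule sum_mono2)
      fix d assume "d \<in> {1..?K} - (?D - {n})"
      then show "0 \<le> point_count d" using point_count_pos[of d] by auto
    qed (use sub in auto)
    also have "\<dots> \<le> 6 * int CARD('a) ^ ?K - 6" by (rule sum_point_count_le)
    finally have "int CARD('a) ^ n \<le> 12 * int CARD('a) ^ ?K - 10" using point_count_ge[OF assms(1)] by linarith
    moreover have "16 * int CARD('a) ^ ?K \<le> int CARD('a) ^ n"
    proof -
      have "16 \<le> CARD('a) ^ (n - ?K)"
      \<comment> \<open>For n = 3 the exponent is 2, so q \<ge> 4 is required; this is where the
        pair (1, 3) is excluded. From n = 5 on the exponent is at least 4 and q \<ge> 2 is
        enough.\<close>
      proof (cases "n = 3")
        case True
        then have "r \<ge> 2" using assms r_pos by auto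
        then have "(2 :: nat) ^ 2 \<le> CARD('a)" unfolding card_field by (intro power_increasing) auto
        then have "(2 ^ 2) ^ 2 \<le> CARD('a) ^ 2" by (intro power_mono) auto
        then show ?thesis using True by simp
      next
        case False
        then have "n \<ge> 5" using \<open>n \<notin> {1, 2, 4}\<close> assms(1) by auto
        then have "4 \<le> n - ?K" by auto
        then have "CARD('a) ^ 4 \<le> CARD('a) ^ (n - ?K)" using q_ge_2 by (intro power_increasing) auto
        moreover have "2 ^ 4 \<le> CARD('a) ^ 4" using q_ge_2 by (intro power_mono) auto
        ultimately show ?thesis by simp
      qed
      then have "16 * CARD('a) ^ ?K \<le> CARD('a) ^ (n - ?K) * CARD('a) ^ ?K" by (rule mult_right_mono) simp
      also have "\<dots> = CARD('a) ^ n" by (simp flip: power_add)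
      finally have "int (16 * CARD('a) ^ ?K) \<le> int (CARD('a) ^ n)" by (simp only: of_nat_le_iff)
      then show ?thesis by simp
    qed
    moreover have "int CARD('a) ^ ?K \<ge> 1" using q_ge_2 by simp
    ultimately show False by linarith
  qed
qed

end

theorem theorem1:
  fixes r q :: nat
  assumes "r \<ge> 1" and "q = 2 ^ r"
    and "CARD('a::{field,finite}) = q"
  shows
    "(\<forall>n k m :: nat. n \<ge> 1 \<and> n = 2 ^ k * m \<and> odd m \<longrightarrow>
        of_nat (A_count TYPE('a) r n) =
          1 / (4 * of_nat n) *
          (\<Sum>d | d dvd m. of_int (moebius (m div d)) *
             (of_nat q ^ (2 ^ k * d) + 1
                - alpha ^ (r * 2 ^ k * d) - cnj alpha ^ (r * 2 ^ k * d))) \<and>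
        \<bar>real (A_count TYPE('a) r n) - real q ^ n / (4 * real n)\<bar> \<le>
          real (sigma0 m) / (4 * real n) *
            (real q powr (real n / 3) + 1 + 2 * 2 powr (real (r * n) / 6))
          + 2 * 2 powr (real (r * n) / 2) / (4 * real n)) \<and>
     (\<lambda>n. real (A_count TYPE('a) r n)) \<sim>[at_top] (\<lambda>n. real q ^ n / (4 * real n)) \<and>
     (\<forall>n::nat. n \<ge> 1 \<and> (r, n) \<noteq> (1, 3) \<longrightarrow> A_count TYPE('a) r n \<ge> 1)"
proof -
  interpret binary_field r "TYPE('a)"
    using assms by unfold_locales simp_all
  show ?thesis
    unfolding assms(3)[symmetric]
  proof (intro conjI allI impI; (elim conjE)?)
    fix n k m :: nat assume n: "n \<ge> 1" "n = 2 ^ k * m" "odd m"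
    have m0: "m > 0" using n by (auto intro: gr0I)
    have "4 * of_nat n * of_nat (A_count TYPE('a) r n) = complex_of_int (4 * int (n * A_count TYPE('a) r n))" by simp
    also have "\<dots> = (\<Sum>d | d dvd m. of_int (moebius (m div d)) * of_int (point_count (2 ^ k * d)))"
      unfolding A_count_eq_moebius_sum[OF n(2,3)] by simp
    also have "\<dots> = (\<Sum>d | d dvd m. of_int (moebius (m div d)) *
             (of_nat CARD('a) ^ (2 ^ k * d) + 1
                - alpha ^ (r * 2 ^ k * d) - cnj alpha ^ (r * 2 ^ k * d)))"
    proof (intro sum.cong refl arg_cong2[where f = "(*)"])
      fix d assume "d \<in> {d. d dvd m}"
      then have "2 ^ k * d \<ge> 1" using m0 by (auto simp: Suc_le_eq intro: gr0I)
      then show "of_int (point_count (2 ^ k * d)) = of_nat CARD('a) ^ (2 ^ k * d) + 1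
                - alpha ^ (r * 2 ^ k * d) - cnj alpha ^ (r * 2 ^ k * d)"
        by (simp add: of_int_point_count mult.assoc)
    qed
    finally show "of_nat (A_count TYPE('a) r n) = 1 / (4 * of_nat n) *
          (\<Sum>d | d dvd m. of_int (moebius (m div d)) *
             (of_nat CARD('a) ^ (2 ^ k * d) + 1
                - alpha ^ (r * 2 ^ k * d) - cnj alpha ^ (r * 2 ^ k * d)))"
      using n(1) by (simp add: field_simps)
    have "real (A_count TYPE('a) r n) - real CARD('a) ^ n / (4 * real n) =
        (4 * real n * real (A_count TYPE('a) r n) - real CARD('a) ^ n) / (4 * real n)"
      using n(1) by (simp add: field_simps)
    then have "\<bar>real (A_count TYPE('a) r n) - real CARD('a) ^ n / (4 * real n)\<bar> =
        \<bar>4 * real n * real (A_count TYPE('a) r n) - real CARD('a) ^ n\<bar> / (4 * real n)" by simp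
    also have "\<dots> \<le> (real (sigma0 m) * (real CARD('a) powr (real n / 3) + 1 + 2 * 2 powr (real (r * n) / 6)) +
      2 * 2 powr (real (r * n) / 2)) / (4 * real n)"
      by (intro divide_right_mono A_count_estimate[OF n(2,3)]) simp
    finally show "\<bar>real (A_count TYPE('a) r n) - real CARD('a) ^ n / (4 * real n)\<bar> \<le>
          real (sigma0 m) / (4 * real n) *
            (real CARD('a) powr (real n / 3) + 1 + 2 * 2 powr (real (r * n) / 6))
          + 2 * 2 powr (real (r * n) / 2) / (4 * real n)"
      by (simp add: add_divide_distrib)
  qed (use A_count_asymp A_count_pos in auto)
qed

end
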